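(* Let $S\subset\mathbb{R}^d$ be a bounded polytope with set of extreme points $\{v^1,\dots,v^M\}$, $M\ge 2$, diameter $D=\sup_{x,y\in S}\|x-y\|$ and facial distance $\psi_S$ (see context). Let $L,\mu>0$ and let $f:\mathbb{R}^d\to\mathbb{R}$ be a convex function that is $L$-smooth and $\mu$-strongly convex on $S$. Let $f^*=\min_{x\in S}f(x)$. Let $\{x^{t,i}\}_{t\ge 0,\,0\le i\le M}$ be a sequence generated by the PolyCDwA algorithm (see context), and write $x^t:=x^{t,0}$. Then: (1) If the line search step sizes are used, i.e. for all $t\ge 0$ and $i\in[M]$ $$\alpha_{t,i}\in\operatorname{argmin}_{\alpha\in[-\gamma_{t,i},1]} f\big(x^{t,i-1}+\alpha(v^i-x^{t,i-1})\big),$$ then, with $G:=1+\dfrac{9MLD^2}{\mu\psi_S^2}$, $$f(x^t)-f^*\le\Big(\frac{G}{1+G}\Big)^t\,(f(x^0)-f^* )\qquad\forall\,t\ge 0.$$ (2) If the one-dimensional gradient step sizes are used, i.e. for all $t\ge 0$ and $i\in[M]$ $$\alpha_{t,i}\in\operatorname{argmin}_{\alpha\in[-\gamma_{t,i},1]}\Big\{\alpha\langle\nabla f(x^{t,i-1}),v^i-x^{t,i-1}\rangle+\frac{L\alpha^2}{2}\|v^i-x^{t,i-1}\|^2\Big\},$$ then, with $G':=2+\dfrac{16MLD^2}{\mu\psi_S^2}$, $$f(x^t)-f^*\le\Big(\frac{G'}{1+G'}\Big)^t\,(f(x^0)-f^* )\qquad\forall\,t\ge 0.$$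
   Context: $\|\cdot\|$ is the Euclidean norm and $[M]=\{1,\dots,M\}$. For a convex set $S$, $f$ is called $L$-smooth on $S$ if it is differentiable and $\|\nabla f(x)-\nabla f(y)\|\le L\|x-y\|$ for all $x,y\in S$; it is $\mu$-strongly convex on $S$ if $f(y)-f(x)\ge\langle\nabla f(x),y-x\rangle+\frac{\mu}{2}\|y-x\|^2$ for all $x,y\in S$. Facial distance: $\psi_S:=\min\{\operatorname{dist}(F,\operatorname{conv}(V(S)\setminus F)) : F\in\operatorname{faces}(S),\ \emptyset\ne F\ne S\}$, where $V(S)=\{v^1,\dots,v^M\}$ is the set of vertices of $S$, $\operatorname{faces}(S)$ is the set of all faces of $S$, and $\operatorname{dist}$ is the Euclidean distance between sets. PolyCDwA algorithm: start from $x^{0,0}\in S$ together with weights $\lambda^{0,0}_1,\dots,\lambda^{0,0}_M\ge 0$, $\sum_{i=1}^M\lambda^{0,0}_i=1$, such that $x^{0,0}=\sum_{i=1}^M\lambda^{0,0}_i v^i$. For $t=0,1,2,\dots$: for $i=1,2,\dots,M$ in order, let $\gamma_{t,i}=\lambda_i^{t,i-1}/(1-\lambda_i^{t,i-1})$ (and $\gamma_{t,i}=\infty$ if $\lambda_i^{t,i-1}=1$, in which case $[-\gamma_{t,i},1]$ means $(-\infty,1]$); choose $\alpha_{t,i}\in[-\gamma_{t,i},1]$ by the step-size rule; set $x^{t,i}=x^{t,i-1}+\alpha_{t,i}(v^i-x^{t,i-1})$, $\lambda_i^{t,i}=(1-\alpha_{t,i})\lambda_i^{t,i-1}+\alpha_{t,i}$,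 and $\lambda_j^{t,i}=(1-\alpha_{t,i})\lambda_j^{t,i-1}$ for all $j\in[M]\setminus\{i\}$. Then set $x^{t+1,0}=x^{t,M}$ and $\lambda^{t+1,0}=\lambda^{t,M}$. *)

theory Defs
  imports "HOL-Analysis.Analysis"
begin

definition gradient :: "('a::real_inner \<Rightarrow> real) \<Rightarrow> 'a \<Rightarrow> 'a" where
  "gradient f x = (THE g. GDERIV f x :> g)"

text \<open>Differentiability is that of \<open>f\<close> as a function on the whole space, at the points of \<open>S\<close>;
  so the gradient is well defined even if \<open>S\<close> is not full-dimensional.\<close>

definition smooth_on_set :: "real \<Rightarrow> 'a::real_inner set \<Rightarrow> ('a \<Rightarrow> real) \<Rightarrow> bool" where
  "smooth_on_set L S f \<longleftrightarrow>
     (\<forall>x\<in>S. f differentiable (at x)) \<and>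
     (\<forall>x\<in>S. \<forall>y\<in>S. norm (gradient f x - gradient f y) \<le> L * norm (x - y))"

definition strongly_convex_on_set :: "real \<Rightarrow> 'a::real_inner set \<Rightarrow> ('a \<Rightarrow> real) \<Rightarrow> bool" where
  "strongly_convex_on_set \<mu> S f \<longleftrightarrow>
     (\<forall>x\<in>S. \<forall>y\<in>S. f y - f x \<ge> gradient f x \<bullet> (y - x) + \<mu> / 2 * (norm (y - x))\<^sup>2)"

definition vertices :: "'a::euclidean_space set \<Rightarrow> 'a set" where
  "vertices S = {v. v extreme_point_of S}"

text \<open>The minimum ranges over a finite set if \<open>S\<close> is a polytope, and this set is nonempty
  if \<open>S\<close> has at least two vertices.\<close>

definition facial_distance :: "'a::euclidean_space set \<Rightarrow> real" where
  "facial_distance S =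
     Min {setdist F (convex hull (vertices S - F)) | F. F face_of S \<and> F \<noteq> {} \<and> F \<noteq> S}"

text \<open>The interval \<open>[-\<gamma>, 1]\<close> with \<open>\<gamma> = l / (1 - l)\<close>, where \<open>\<gamma> = \<infinity>\<close> if \<open>l = 1\<close>.\<close>

definition step_interval :: "real \<Rightarrow> real set" where
  "step_interval l = (if l = 1 then {..1} else {- (l / (1 - l))..1})"

text \<open>\<open>X t i\<close>, \<open>lam t i j\<close> and \<open>alpha t i\<close> stand for \<open>x\<^sup>t\<^sup>,\<^sup>i\<close>, \<open>\<lambda>\<^sub>j\<^sup>t\<^sup>,\<^sup>i\<close> and \<open>\<alpha>\<^sub>t\<^sub>,\<^sub>i\<close>.
  The values of \<open>X t\<close> and \<open>lam t\<close> beyond \<open>M\<close>, of \<open>lam t i\<close> outside \<open>{1..M}\<close> and of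
  \<open>alpha t\<close> outside \<open>{1..M}\<close> are irrelevant. The step-size rule is left open here.\<close>

definition PolyCDwA ::
  "'a::euclidean_space set \<Rightarrow> nat \<Rightarrow> (nat \<Rightarrow> 'a) \<Rightarrow> (nat \<Rightarrow> nat \<Rightarrow> 'a) \<Rightarrow>
   (nat \<Rightarrow> nat \<Rightarrow> nat \<Rightarrow> real) \<Rightarrow> (nat \<Rightarrow> nat \<Rightarrow> real) \<Rightarrow> bool" where
  "PolyCDwA S M v X lam alpha \<longleftrightarrow>
     X 0 0 \<in> S \<and>
     (\<forall>j\<in>{1..M}. lam 0 0 j \<ge> 0) \<and>
     (\<Sum>j=1..M. lam 0 0 j) = 1 \<and>
     X 0 0 = (\<Sum>j=1..M. lam 0 0 j *\<^sub>R v j) \<and>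
     (\<forall>t. \<forall>i\<in>{1..M}.
        alpha t i \<in> step_interval (lam t (i - 1) i) \<and>
        X t i = X t (i - 1) + alpha t i *\<^sub>R (v i - X t (i - 1)) \<and>
        lam t i i = (1 - alpha t i) * lam t (i - 1) i + alpha t i \<and>
        (\<forall>j\<in>{1..M} - {i}. lam t i j = (1 - alpha t i) * lam t (i - 1) j)) \<and>
     (\<forall>t. X (Suc t) 0 = X t M \<and> (\<forall>j\<in>{1..M}. lam (Suc t) 0 j = lam t M j))"

definition line_search_steps ::
  "('a::euclidean_space \<Rightarrow> real) \<Rightarrow> nat \<Rightarrow> (nat \<Rightarrow> 'a) \<Rightarrow> (nat \<Rightarrow> nat \<Rightarrow> 'a) \<Rightarrow>
   (nat \<Rightarrow> nat \<Rightarrow> nat \<Rightarrow> real) \<Rightarrow> (nat \<Rightarrow> nat \<Rightarrow> real) \<Rightarrow> bool" where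
  "line_search_steps f M v X lam alpha \<longleftrightarrow>
     (\<forall>t. \<forall>i\<in>{1..M}.
        is_arg_min (\<lambda>a. f (X t (i - 1) + a *\<^sub>R (v i - X t (i - 1))))
          (\<lambda>a. a \<in> step_interval (lam t (i - 1) i)) (alpha t i))"

definition gradient_steps ::
  "real \<Rightarrow> ('a::euclidean_space \<Rightarrow> real) \<Rightarrow> nat \<Rightarrow> (nat \<Rightarrow> 'a) \<Rightarrow> (nat \<Rightarrow> nat \<Rightarrow> 'a) \<Rightarrow>
   (nat \<Rightarrow> nat \<Rightarrow> nat \<Rightarrow> real) \<Rightarrow> (nat \<Rightarrow> nat \<Rightarrow> real) \<Rightarrow> bool" where
  "gradient_steps L f M v X lam alpha \<longleftrightarrow>
     (\<forall>t. \<forall>i\<in>{1..M}.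
        is_arg_min
          (\<lambda>a. a * (gradient f (X t (i - 1)) \<bullet> (v i - X t (i - 1)))
               + L * a\<^sup>2 / 2 * (norm (v i - X t (i - 1)))\<^sup>2)
          (\<lambda>a. a \<in> step_interval (lam t (i - 1) i)) (alpha t i))"

end

theory Submission
  imports Defs
begin

text \<open>
  Let \<open>\<Delta>\<close> be the decrease of \<open>f\<close> in one sweep. It suffices to bound the optimality gap by a multiple
  of \<open>\<Delta>\<close>. If \<open>x\<^sup>*\<close> is a minimizer and \<open>x\<close> has weights \<open>\<lambda>\<close>, the facial distance provides weights
  \<open>\<lambda>\<^sup>*\<close> of \<open>x\<^sup>*\<close> with \<open>\<psi> \<parallel>\<lambda> - \<lambda>\<^sup>*\<parallel>\<^sub>1 \<le> 2 \<parallel>x - x\<^sup>*\<parallel>\<close>. So it remains to estimate the sum over \<open>i\<close> of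
  \<open>\<lambda>\<^sub>i - \<lambda>\<^sup>*\<^sub>i\<close> times the directional derivative at \<open>x\<close> towards \<open>v\<^sup>i\<close>. The optimality of
  the \<open>i\<close>-th step determines the sign of the derivative at the \<open>i\<close>-th iterate of the sweep, and the
  gradient has to be transported from there to \<open>x\<close>.

  For gradient steps, \<open>x\<close> is the last point of the sweep and the Lipschitz continuity of the gradient
  is enough, because the squared step lengths are bounded by \<open>2 \<Delta>\<^sub>j / L\<close>.

  Exact line search only bounds them by \<open>2 \<Delta>\<^sub>j / \<mu>\<close>, which would cost a factor \<open>L / \<mu>\<close>, and
  since \<open>f\<close> is smooth on \<open>S\<close> only, cocoercivity of the gradient is not available. Here \<open>x\<close> is the first
  point of the sweep, and each gradient change is tested against a single feasible displacement that
  moves the weights of all coordinates not yet processed towards \<open>\<lambda>\<^sup>*\<close>. Feasibility can fail only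
  if the sweep has scaled down these weights substantially. In that case all weight outside one
  vertex is bounded by the total step length, and hence by a multiple of the square root of \<open>M \<Delta> / (\<mu> \<psi>\<^sup>2)\<close>.
\<close>

text \<open>Sums and indices run over \<open>{1..M}\<close>; this keeps \<open>1\<close> from being
  rewritten to \<open>Suc 0\<close>.\<close>

declare One_nat_def [simp del]

section \<open>Smooth functions and faces\<close>

text \<open>\<open>gradient\<close> is a definite description. Existence is Riesz representation in
  the standard basis, uniqueness is that of the Frechet derivative.\<close>

lemma has_derivative_gradient:
  fixes f :: "'a::euclidean_space \<Rightarrow> real"
  assumes "f differentiable (at x)"
  shows "(f has_derivative (\<lambda>h. gradient f x \<bullet> h)) (at x)"
proof -
  obtain F where F: "(f has_derivative F) (at x)"
    using assms by (auto simp: differentiable_def)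
  interpret F: linear F
    using F by (rule has_derivative_linear)
  define g where "g = (\<Sum>b\<in>Basis. F b *\<^sub>R b)"
  have "F h = h \<bullet> g" for h
  proof -
    have "F h = F (\<Sum>b\<in>Basis. (h \<bullet> b) *\<^sub>R b)"
      by (simp add: euclidean_representation)
    also have "\<dots> = (\<Sum>b\<in>Basis. (h \<bullet> b) * F b)"
      by (simp add: F.sum F.scaleR)
    finally show ?thesis
      by (simp add: g_def inner_sum_right mult.commute)
  qed
  then have "F = (\<lambda>h. h \<bullet> g)"
    by blast
  then have g: "GDERIV f x :> g"
    using F by (simp add: gderiv_def)
  have "GDERIV f x :> gradient f x"
    unfolding gradient_def
  proof (rule theI)
    show "GDERIV f x :> g" by (fact g)
    fix g' assume "GDERIV f x :> g'"
    then have "(\<lambda>h. h \<bullet> g') = (\<lambda>h. h \<bullet> g)"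
      using g has_derivative_unique unfolding gderiv_def by blast
    then show "g' = g"
      by (metis vector_eq_ldot)
  qed
  then show ?thesis
    by (simp add: gderiv_def inner_commute)
qed

lemma DERIV_along_line:
  fixes f :: "'a::euclidean_space \<Rightarrow> real"
  assumes "f differentiable (at (x + a *\<^sub>R r))"
  shows "((\<lambda>a. f (x + a *\<^sub>R r)) has_field_derivative gradient f (x + a *\<^sub>R r) \<bullet> r) (at a)"
proof -
  have "((\<lambda>a. x + a *\<^sub>R r) has_derivative (\<lambda>h. h *\<^sub>R r)) (at a)"
    by (auto intro!: derivative_eq_intros)
  from has_derivative_compose[OF this has_derivative_gradient[OF assms]]
  show ?thesis
    by (simp add: has_field_derivative_def mult_commute_abs)
qed

lemma smooth_on_set_lipschitz:
  "smooth_on_set L S f \<Longrightarrow> x \<in> S \<Longrightarrow> y \<in> S \<Longrightarrow> norm (gradient f x - gradient f y) \<le> L * norm (x - y)"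
  by (simp add: smooth_on_set_def)

text \<open>The descent lemma: along the segment, which stays in \<open>S\<close> by convexity,
  \<open>f\<close> minus its quadratic model at \<open>x\<close> has nonpositive derivative.\<close>

lemma smooth_upper_bound:
  fixes f :: "'a::euclidean_space \<Rightarrow> real"
  assumes "convex S" and sm: "smooth_on_set L S f" and "x \<in> S" "y \<in> S"
  shows "f y \<le> f x + gradient f x \<bullet> (y - x) + L / 2 * (norm (y - x))\<^sup>2"
proof -
  define r where "r = y - x"
  define \<phi> where "\<phi> = (\<lambda>t. f (x + t *\<^sub>R r) - t * (gradient f x \<bullet> r) - L / 2 * t\<^sup>2 * (norm r)\<^sup>2)"
  have inS: "x + t *\<^sub>R r \<in> S" if "0 \<le> t" "t \<le> 1" for t
  proof -
    have "x + t *\<^sub>R r = (1 - t) *\<^sub>R x + t *\<^sub>R y"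
      by (simp add: r_def algebra_simps)
    then show ?thesis
      using convexD_alt[OF assms(1,3,4)] that by simp
  qed
  have "\<phi> 1 \<le> \<phi> 0"
  proof (rule DERIV_nonpos_imp_nonincreasing[where f = \<phi> and a = 0 and b = 1])
    fix t :: real assume t: "0 \<le> t" "t \<le> 1"
    let ?y = "x + t *\<^sub>R r"
    have y: "?y \<in> S" using inS t by blast
    have "(\<phi> has_field_derivative
      gradient f ?y \<bullet> r - gradient f x \<bullet> r - L / 2 * (2 * t) * (norm r)\<^sup>2) (at t)"
      unfolding \<phi>_def
      by (rule derivative_eq_intros DERIV_along_line refl | use sm y in \<open>simp add: smooth_on_set_def\<close>)+
    moreover have "gradient f ?y \<bullet> r - gradient f x \<bullet> r \<le> L * t * (norm r)\<^sup>2"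
    proof -
      have "gradient f ?y \<bullet> r - gradient f x \<bullet> r = (gradient f ?y - gradient f x) \<bullet> r"
        by (simp add: inner_diff_left)
      also have "\<dots> \<le> norm (gradient f ?y - gradient f x) * norm r"
        by (rule norm_cauchy_schwarz)
      also have "\<dots> \<le> L * norm (?y - x) * norm r"
        using smooth_on_set_lipschitz[OF sm y assms(3)] by (intro mult_right_mono) auto
      finally show ?thesis
        using t by (simp add: power2_eq_square mult.assoc)
    qed
    ultimately show "\<exists>d. (\<phi> has_real_derivative d) (at t) \<and> d \<le> 0"
      by (intro exI conjI) (assumption, simp)
  qed simp
  then show ?thesis
    by (simp add: \<phi>_def r_def)
qed

text \<open>First-order optimality in the form used for both step-size rules: a nonzero derivative
  pins the step to one particular endpoint.\<close>

lemma arg_min_interval_derivative: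
  fixes \<phi> :: "real \<Rightarrow> real"
  assumes min: "is_arg_min \<phi> (\<lambda>a. a \<in> {l..u}) a"
    and der: "(\<phi> has_field_derivative d) (at a)"
  shows "d > 0 \<Longrightarrow> a = l" and "d < 0 \<Longrightarrow> a = u"
proof -
  have a: "l \<le> a" "a \<le> u" and le: "\<And>b. l \<le> b \<Longrightarrow> b \<le> u \<Longrightarrow> \<phi> a \<le> \<phi> b"
    using min by (auto simp: is_arg_min_linorder)
  show "a = l" if d: "d > 0"
  proof (rule ccontr)
    assume "a \<noteq> l"
    obtain e where e: "e > 0" "\<And>h. 0 < h \<Longrightarrow> h < e \<Longrightarrow> \<phi> (a - h) < \<phi> a"
      using DERIV_pos_inc_left[OF der d] by blast
    define h where "h = min (e / 2) (a - l)"
    have "0 < h" "h < e" "h \<le> a - l"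
      using e(1) a \<open>a \<noteq> l\<close> by (auto simp: h_def)
    then show False
      using e(2)[of h] le[of "a - h"] a by auto
  qed
  show "a = u" if d: "d < 0"
  proof (rule ccontr)
    assume "a \<noteq> u"
    obtain e where e: "e > 0" "\<And>h. 0 < h \<Longrightarrow> h < e \<Longrightarrow> \<phi> a > \<phi> (a + h)"
      using DERIV_neg_dec_right[OF der d] by blast
    define h where "h = min (e / 2) (u - a)"
    have "0 < h" "h < e" "h \<le> u - a"
      using e(1) a \<open>a \<noteq> u\<close> by (auto simp: h_def)
    then show False
      using e(2)[of h] le[of "a + h"] a by auto
  qed
qed

lemma sum_nested_triangle:
  fixes c :: "nat \<Rightarrow> nat \<Rightarrow> 'b::comm_monoid_add"
  shows "(\<Sum>i=1..M. \<Sum>j=1..i. c i j) = (\<Sum>j=1..M. \<Sum>i=j..M. c i j)"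
proof -
  have "(\<Sum>i=1..M. \<Sum>j=1..i. c i j) = (\<Sum>i=1..M. \<Sum>j\<in>{j \<in> {1..M}. j \<le> i}. c i j)"
    by (intro sum.cong) auto
  also have "\<dots> = (\<Sum>j=1..M. \<Sum>i\<in>{i \<in> {1..M}. j \<le> i}. c i j)"
    by (rule sum.swap_restrict) auto
  also have "\<dots> = (\<Sum>j=1..M. \<Sum>i=j..M. c i j)"
    by (intro sum.cong) auto
  finally show ?thesis .
qed

section \<open>Faces of convex sets\<close>

lemma face_of_complement_convex:
  assumes "convex S" "F face_of S"
  shows "convex (S - F)"
  unfolding convex_contains_open_segment
proof (intro ballI subsetI)
  fix a b x assume ab: "a \<in> S - F" "b \<in> S - F" and x: "x \<in> open_segment a b"
  have "x \<in> S"
    using assms(1) ab x by (metis DiffD1 convex_contains_open_segment subsetD)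
  moreover have "x \<notin> F"
    using assms(2) ab x by (auto simp: face_of_def)
  ultimately show "x \<in> S - F" by simp
qed

text \<open>The smallest face containing \<open>w\<close>.\<close>

lemma face_of_extendable_points:
  assumes S: "convex S" and w: "w \<in> S"
  shows "{y \<in> S. \<exists>e>0. w + e *\<^sub>R (w - y) \<in> S} face_of S" (is "?F face_of S")
proof -
  have shrink: "w + e' *\<^sub>R (w - y) \<in> S" if "w + e *\<^sub>R (w - y) \<in> S" "0 \<le> e'" "e' \<le> e" "e > 0" for e e' y
  proof -
    have "w + e' *\<^sub>R (w - y) = (1 - e' / e) *\<^sub>R w + (e' / e) *\<^sub>R (w + e *\<^sub>R (w - y))"
      using that by (simp add: algebra_simps)
    then show ?thesis
      using convexD_alt[OF S w that(1), of "e' / e"] that by simp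
  qed
  have "convex ?F" (is ?conv)
  proof (rule convexI)
    fix y z :: 'a and p q :: real
    assume y: "y \<in> ?F" and z: "z \<in> ?F" and pq: "0 \<le> p" "0 \<le> q" "p + q = 1"
    obtain d e where de: "d > 0" "w + d *\<^sub>R (w - y) \<in> S" "e > 0" "w + e *\<^sub>R (w - z) \<in> S"
      using y z by blast
    let ?m = "min d e"
    have "p *\<^sub>R (w + ?m *\<^sub>R (w - y)) + q *\<^sub>R (w + ?m *\<^sub>R (w - z)) \<in> S"
      using convexD[OF S shrink[OF de(2), of ?m] shrink[OF de(4), of ?m] pq] de by simp
    moreover have "p *\<^sub>R (w + ?m *\<^sub>R (w - y)) + q *\<^sub>R (w + ?m *\<^sub>R (w - z))
        = (p + q) *\<^sub>R (w + ?m *\<^sub>R w) - ?m *\<^sub>R (p *\<^sub>R y + q *\<^sub>R z)"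
      by (simp add: algebra_simps)
    ultimately have "w + ?m *\<^sub>R (w - (p *\<^sub>R y + q *\<^sub>R z)) \<in> S"
      using pq by (simp add: algebra_simps)
    moreover have "p *\<^sub>R y + q *\<^sub>R z \<in> S"
      using y z pq by (intro convexD[OF S]) auto
    moreover have "?m > 0" using de by simp
    ultimately show "p *\<^sub>R y + q *\<^sub>R z \<in> ?F" by blast
  qed
  have extend: "a \<in> ?F"
    if a: "a \<in> S" and b: "b \<in> S" and x: "x \<in> ?F" and t: "0 < t" "t < 1"
      and eq: "x = (1 - t) *\<^sub>R a + t *\<^sub>R b" for a b x and t :: real
  proof -
    obtain e where e: "e > 0" "w + e *\<^sub>R (w - x) \<in> S"
      using x by blast
    \<comment> \<open>Adding \<open>e * t\<close> times \<open>b\<close> to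
      \<open>w + e *\<^sub>R (w - x)\<close> cancels \<open>b\<close>, leaving only \<open>w\<close>
      and \<open>a\<close>; dividing by \<open>k\<close> turns this into a convex
      combination.\<close>
    define k where "k = 1 + e * t"
    have k: "k > 0" using e t by (simp add: k_def add_pos_pos)
    have "(1 / k) *\<^sub>R (w + e *\<^sub>R (w - x)) + (e * t / k) *\<^sub>R b \<in> S"
      using e t k b by (intro convexD[OF S]) (auto simp: k_def field_simps)
    moreover have "(1 / k) *\<^sub>R (w + e *\<^sub>R (w - x)) + (e * t / k) *\<^sub>R b
        = w + (e * (1 - t) / k) *\<^sub>R (w - a)"
    proof -
      have "k *\<^sub>R ((1 / k) *\<^sub>R (w + e *\<^sub>R (w - x)) + (e * t / k) *\<^sub>R b)
          = k *\<^sub>R (w + (e * (1 - t) / k) *\<^sub>R (w - a))"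
        using k by (simp add: scaleR_add_right eq) (simp add: k_def algebra_simps)
      then show ?thesis using k by simp
    qed
    moreover have "e * (1 - t) / k > 0" using e t k by simp
    ultimately show ?thesis using a by force
  qed
  have seg: "a \<in> ?F \<and> b \<in> ?F"
    if ab: "a \<in> S" "b \<in> S" and x: "x \<in> ?F" and seg: "x \<in> open_segment a b" for a b x
  proof -
    obtain t where t: "0 < t" "t < 1" "x = (1 - t) *\<^sub>R a + t *\<^sub>R b"
      using seg by (auto simp: in_segment)
    then show ?thesis
      using extend[OF ab x t] extend[OF ab(2,1) x, of "1 - t"] by (simp add: add.commute)
  qed
  have "?F \<subseteq> S" by blast
  then show ?thesis
    unfolding face_of_def using \<open>?conv\<close> seg by (intro conjI ballI impI) blast+
qed

section \<open>The facial distance of a polytope\<close>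

locale vertex_polytope =
  fixes S :: "'a::euclidean_space set" and M :: nat and v :: "nat \<Rightarrow> 'a"
  assumes polytope: "polytope S" and two_vertices: "M \<ge> 2"
    and bij: "bij_betw v {1..M} (vertices S)"
begin

definition weights :: "(nat \<Rightarrow> real) \<Rightarrow> bool" where
  "weights l \<longleftrightarrow> (\<forall>i\<in>{1..M}. l i \<ge> 0) \<and> (\<Sum>i=1..M. l i) = 1"

definition pt :: "(nat \<Rightarrow> real) \<Rightarrow> 'a" where
  "pt l = (\<Sum>i=1..M. l i *\<^sub>R v i)"

lemma weights_nonneg: "weights l \<Longrightarrow> i \<in> {1..M} \<Longrightarrow> l i \<ge> 0"
  by (simp add: weights_def)

lemma weights_sum: "weights l \<Longrightarrow> (\<Sum>i=1..M. l i) = 1"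
  by (simp add: weights_def)

lemma compact_S: "compact S" and convex_S: "convex S"
  using polytope polytope_imp_compact polytope_imp_convex by auto

lemma vertices_eq: "vertices S = v ` {1..M}"
  using bij by (simp add: bij_betw_def)

lemma inj_v: "inj_on v {1..M}"
  using bij by (rule bij_betw_imp_inj_on)

lemma S_eq: "S = convex hull (v ` {1..M})"
  using Krein_Milman_Minkowski[OF compact_S convex_S] unfolding vertices_eq[symmetric] vertices_def .

lemma vertex_in_S: "i \<in> {1..M} \<Longrightarrow> v i \<in> S"
  by (simp add: S_eq hull_inc)

lemma pt_in_S: "weights l \<Longrightarrow> pt l \<in> S"
  unfolding pt_def using convex_S
  by (intro convex_sum) (auto simp: weights_def vertex_in_S)

lemma pt_surj:
  assumes "x \<in> S" obtains l where "weights l" "pt l = x"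
proof -
  obtain u where u: "\<forall>y\<in>v ` {1..M}. 0 \<le> u y" "sum u (v ` {1..M}) = 1"
      "(\<Sum>y\<in>v ` {1..M}. u y *\<^sub>R y) = x"
    using assms unfolding S_eq convex_hull_finite[OF finite_imageI[OF finite_atLeastAtMost]] by auto
  have "weights (u \<circ> v)" "pt (u \<circ> v) = x"
    using u by (auto simp: weights_def pt_def sum.reindex[OF inj_v])
  then show ?thesis using that by blast
qed

lemma weights_le_1: "weights l \<Longrightarrow> i \<in> {1..M} \<Longrightarrow> l i \<le> 1"
  using member_le_sum[of i "{1..M}" l] by (auto simp: weights_def)

lemma weights_le_compl:
  assumes "weights l" "i \<in> {1..M}" "j \<in> {1..M}" "i \<noteq> j" shows "l i \<le> 1 - l j"
proof -
  have "sum l {i, j} \<le> (\<Sum>i=1..M. l i)"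
    using assms by (intro sum_mono2) (auto simp: weights_def)
  then show ?thesis using assms by (simp add: weights_def)
qed

lemma dist_le_diameter: "x \<in> S \<Longrightarrow> y \<in> S \<Longrightarrow> norm (x - y) \<le> diameter S"
  using diameter_bounded_bound[OF compact_imp_bounded[OF compact_S]] by (simp add: dist_norm)

text \<open>The summand of \<open>v i\<close> itself vanishes, so only the mass
  \<open>1 - l i\<close> outside it pays the diameter.\<close>

lemma norm_diff_pt_le:
  assumes "weights l" "i \<in> {1..M}"
  shows "norm (v i - pt l) \<le> (1 - l i) * diameter S"
proof -
  have "v i - pt l = (\<Sum>j=1..M. l j *\<^sub>R (v i - v j))"
    using assms by (simp add: pt_def scaleR_diff_right sum_subtractf weights_sum flip: scaleR_left.sum)
  also have "\<dots> = (\<Sum>j\<in>{1..M} - {i}. l j *\<^sub>R (v i - v j))"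
    using assms by (subst sum.remove[of _ i]) auto
  also have "norm \<dots> \<le> (\<Sum>j\<in>{1..M} - {i}. l j * diameter S)"
  proof (rule sum_norm_le)
    fix j assume "j \<in> {1..M} - {i}"
    then show "norm (l j *\<^sub>R (v i - v j)) \<le> l j * diameter S"
      using mult_left_mono[OF dist_le_diameter[OF vertex_in_S[of i] vertex_in_S[of j]]
          weights_nonneg[OF assms(1), of j]] weights_nonneg[OF assms(1), of j] assms(2)
      by simp
  qed
  also have "\<dots> = (1 - l i) * diameter S"
    using assms by (simp add: sum_diff1 weights_sum flip: sum_distrib_right)
  finally show ?thesis .
qed

lemma facial_distance_le:
  assumes "F face_of S" "F \<noteq> {}" "F \<noteq> S"
  shows "facial_distance S \<le> setdist F (convex hull (vertices S - F))"
  unfolding facial_distance_def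
  using assms finite_polytope_faces[OF polytope] by (intro Min_le) auto

lemma singleton_face:
  assumes "i \<in> {1..M}" shows "{v i} face_of S" "{v i} \<noteq> S"
proof -
  show "{v i} face_of S"
    using assms vertices_eq by (auto simp: face_of_singleton vertices_def)
  define j :: nat where "j = (if i = 1 then 2 else 1)"
  have "j \<in> {1..M}" "j \<noteq> i"
    using two_vertices by (auto simp: j_def)
  then have "v j \<noteq> v i"
    using inj_onD[OF inj_v, of j i] assms by blast
  then show "{v i} \<noteq> S" using vertex_in_S[OF \<open>j \<in> {1..M}\<close>] by auto
qed

text \<open>A proper face and the hull of the vertices outside it are disjoint, because the
  complement of a face is convex. Both are compact, and there are finitely many faces.\<close>

lemma facial_distance_pos: "facial_distance S > 0"
proof -
  let ?A = "{setdist F (convex hull (vertices S - F)) | F. F face_of S \<and> F \<noteq> {} \<and> F \<noteq> S}"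
  have fin: "finite ?A" using finite_polytope_faces[OF polytope] by auto
  have ne: "?A \<noteq> {}" using singleton_face[of 1] two_vertices by fastforce
  have "\<forall>d\<in>?A. d > 0"
  proof clarify
    fix F assume F: "F face_of S" "F \<noteq> {}" "F \<noteq> S"
    have "compact F" using F(1) compact_S convex_S face_of_imp_compact by blast
    moreover have "closed (convex hull (vertices S - F))"
      by (simp add: vertices_eq compact_imp_closed finite_imp_compact_convex_hull)
    \<comment> \<open>\<open>setdist\<close> to the empty set is 0, so emptiness has to be
      excluded.\<close>
    moreover have "vertices S - F \<noteq> {}"
    proof
      assume "vertices S - F = {}"
      then have "convex hull (v ` {1..M}) \<subseteq> F"
        using F(1) by (intro hull_minimal) (auto simp: vertices_eq face_of_def)
      then show False using F S_eq by (auto simp: face_of_def)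
    qed
    moreover have "convex hull (vertices S - F) \<subseteq> S - F"
      using face_of_complement_convex[OF convex_S F(1)] vertex_in_S
      by (intro hull_minimal) (auto simp: vertices_eq)
    ultimately show "setdist F (convex hull (vertices S - F)) > 0"
      using F by (subst setdist_gt_0_compact_closed) auto
  qed
  then show ?thesis
    unfolding facial_distance_def using Min_in[OF fin ne] by blast
qed

text \<open>Renormalizing the other weights gives a point \<open>y\<close> in the hull of the other
  vertices, and \<open>v i - pt l\<close> is \<open>1 - l i\<close> times \<open>v i - y\<close>.
  The face used is \<open>{v i}\<close>.\<close>

lemma facial_distance_le_norm_vertex:
  assumes "weights l" "i \<in> {1..M}"
  shows "facial_distance S * (1 - l i) \<le> norm (v i - pt l)"
proof (cases "l i = 1")
  case False
  define k where "k = 1 - l i"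
  have k: "k > 0" using weights_le_1[OF assms] False by (simp add: k_def)
  define y where "y = (\<Sum>j\<in>{1..M} - {i}. (l j / k) *\<^sub>R v j)"
  have y: "y \<in> convex hull (vertices S - {v i})"
    unfolding y_def
  proof (intro convex_sum)
    show "(\<Sum>j\<in>{1..M} - {i}. l j / k) = 1"
      using assms k by (simp add: sum_diff1 weights_sum k_def flip: sum_divide_distrib)
    show "v j \<in> convex hull (vertices S - {v i})" if "j \<in> {1..M} - {i}" for j
      using that inj_onD[OF inj_v, of j i] assms by (intro hull_inc) (auto simp: vertices_eq)
  qed (use assms k in \<open>auto simp: weights_def\<close>)
  have "facial_distance S \<le> setdist {v i} (convex hull (vertices S - {v i}))"
    by (intro facial_distance_le singleton_face[OF assms(2)]) simp
  also have "\<dots> \<le> dist (v i) y"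
    by (intro setdist_le_dist y) simp
  finally have "facial_distance S \<le> norm (v i - y)"
    by (simp add: dist_norm)
  moreover have "pt l = l i *\<^sub>R v i + k *\<^sub>R y"
    using assms k unfolding pt_def y_def by (subst sum.remove[of _ i]) (auto simp: scaleR_sum_right)
  then have "v i - pt l = k *\<^sub>R (v i - y)"
    by (simp add: k_def algebra_simps)
  ultimately show ?thesis
    using k by (simp add: k_def mult.commute)
qed simp

text \<open>The lower and upper bounds on the distance to a vertex are compared for
  \<open>v 1\<close> and the point \<open>v 2\<close>.\<close>

lemma facial_distance_le_diameter: "facial_distance S \<le> diameter S"
proof -
  have i: "1 \<in> {1..M}" "2 \<in> {1..M}" using two_vertices by auto
  define l where "l = (\<lambda>i::nat. if i = 2 then 1 else 0 :: real)"
  have l: "weights l" using i by (simp add: weights_def l_def)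
  have "facial_distance S * (1 - l 1) \<le> (1 - l 1) * diameter S"
    using facial_distance_le_norm_vertex[OF l i(1)] norm_diff_pt_le[OF l i(1)] by linarith
  then show ?thesis by (simp add: l_def)
qed

section \<open>From the facial distance to an error bound for weights\<close>

lemma exists_l1_closest_weights:
  assumes "y \<in> S"
  obtains m where "weights m" "pt m = y"
    "\<And>m'. weights m' \<Longrightarrow> pt m' = y \<Longrightarrow> (\<Sum>i=1..M. \<bar>l i - m i\<bar>) \<le> (\<Sum>i=1..M. \<bar>l i - m' i\<bar>)"
proof -
  \<comment> \<open>Weights are total functions; forcing them to be 0 outside \<open>{1..M}\<close>
    makes \<open>B\<close> a product of compact sets. \<open>trunc\<close> maps arbitrary weights
    there without changing the point or the distance.\<close>
  define B where "B = PiE UNIV (\<lambda>i. if i \<in> {1..M} then {0..1} else {0::real})"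
  define W where "W = B \<inter> {m. (\<Sum>i=1..M. m i) = 1 \<and> pt m = y}"
  have in_W: "weights m \<and> pt m = y" if "m \<in> W" for m
  proof -
    have "m i \<ge> 0" if "i \<in> {1..M}" for i
    proof -
      have "m i \<in> (if i \<in> {1..M} then {0..1} else {0})"
        using \<open>m \<in> W\<close> PiE_mem[of m UNIV "\<lambda>i. if i \<in> {1..M} then {0..1} else {0}" i]
        unfolding W_def B_def by blast
      then show ?thesis using that by simp
    qed
    then show ?thesis using that by (auto simp: W_def weights_def)
  qed
  define trunc where "trunc m = (\<lambda>i. if i \<in> {1..M} then m i else 0)" for m :: "nat \<Rightarrow> real"
  have trunc: "trunc m \<in> W" if "weights m" "pt m = y" for m
    using that weights_nonneg[OF that(1)] weights_le_1[OF that(1)]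
    by (auto simp: W_def B_def trunc_def weights_def pt_def PiE_iff)
  have "compactin (product_topology (\<lambda>_. euclidean) UNIV) B"
    unfolding B_def by (subst compactin_PiE) auto
  then have "compact B"
    by (simp add: euclidean_product_topology)
  moreover have "closed {m. (\<Sum>i=1..M. m i) = 1 \<and> pt m = y}"
    unfolding pt_def by (intro closed_Collect_conj closed_Collect_eq continuous_intros) auto
  ultimately have "compact W"
    unfolding W_def by (rule compact_Int_closed)
  moreover obtain m0 where "weights m0" "pt m0 = y"
    using pt_surj[OF assms] .
  then have "W \<noteq> {}"
    using trunc by blast
  moreover have "continuous_on W (\<lambda>m. \<Sum>i=1..M. \<bar>l i - m i\<bar>)"
    by (intro continuous_intros continuous_on_subset[OF continuous_on_product_coordinates]) auto
  ultimately have "\<exists>m\<in>W. \<forall>m'\<in>W. (\<Sum>i=1..M. \<bar>l i - m i\<bar>) \<le> (\<Sum>i=1..M. \<bar>l i - m' i\<bar>)"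
    by (rule continuous_attains_inf)
  then obtain m where m: "m \<in> W"
      "\<And>m'. m' \<in> W \<Longrightarrow> (\<Sum>i=1..M. \<bar>l i - m i\<bar>) \<le> (\<Sum>i=1..M. \<bar>l i - m' i\<bar>)"
    by blast
  show ?thesis
  proof (rule that)
    show "weights m" "pt m = y" using in_W[OF m(1)] by auto
    fix m' assume "weights m'" "pt m' = y"
    from m(2)[OF trunc[OF this]]
    show "(\<Sum>i=1..M. \<bar>l i - m i\<bar>) \<le> (\<Sum>i=1..M. \<bar>l i - m' i\<bar>)"
      by (simp add: trunc_def)
  qed
qed

text \<open>In an \<open>\<ell>\<^sub>1\<close>-closest representation, no vertex that loses weight lies in the smallest face
  containing the barycentre \<open>w\<close> of the gained weight: otherwise part of the gain could be rewritten
  so as to return weight to that vertex.\<close>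

lemma weights_error_bound:
  assumes l: "weights l" and y: "y \<in> S"
  obtains m where "weights m" "pt m = y"
    "facial_distance S * (\<Sum>i=1..M. \<bar>l i - m i\<bar>) \<le> 2 * norm (pt l - y)"
proof -
  obtain m where m: "weights m" "pt m = y" and
    least: "\<And>m'. weights m' \<Longrightarrow> pt m' = y \<Longrightarrow> (\<Sum>i=1..M. \<bar>l i - m i\<bar>) \<le> (\<Sum>i=1..M. \<bar>l i - m' i\<bar>)"
    using exists_l1_closest_weights[OF y, of l] by metis
  \<comment> \<open>\<open>p\<close> is the weight lost and \<open>n\<close> the weight gained in
    passing from \<open>l\<close> to \<open>m\<close>. Both have total \<open>t\<close>; their
    barycentres will be \<open>u\<close> and \<open>w\<close>.\<close>
  define p where "p i = max (l i - m i) 0" for i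
  define n where "n i = max (m i - l i) 0" for i
  define t where "t = (\<Sum>i=1..M. p i)"
  have pn: "p i - n i = l i - m i" "p i + n i = \<bar>l i - m i\<bar>" "p i \<ge> 0" "n i \<ge> 0" for i
    by (auto simp: p_def n_def)
  have n_le: "n i \<le> m i" and p_le: "p i \<le> l i" if "i \<in> {1..M}" for i
    using weights_nonneg[OF l that] weights_nonneg[OF m(1) that] by (auto simp: n_def p_def)
  have "(\<Sum>i=1..M. p i - n i) = 0"
    unfolding pn using l m(1) by (simp add: sum_subtractf weights_sum)
  then have tn: "(\<Sum>i=1..M. n i) = t"
    by (simp add: t_def sum_subtractf)
  have sum_abs: "(\<Sum>i=1..M. \<bar>l i - m i\<bar>) = 2 * t"
    by (simp add: pn(2)[symmetric] sum.distrib tn) (simp add: t_def)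
  have "t \<ge> 0" unfolding t_def by (intro sum_nonneg pn)
  have "facial_distance S * t \<le> norm (pt l - y)"
  proof (cases "t = 0")
    case False
    then have t: "t > 0" using \<open>t \<ge> 0\<close> by simp
    define w where "w = (\<Sum>i=1..M. (n i / t) *\<^sub>R v i)"
    define u where "u = (\<Sum>i=1..M. (p i / t) *\<^sub>R v i)"
    have "pt l - y = (\<Sum>i=1..M. (p i - n i) *\<^sub>R v i)"
      unfolding pn(1) m(2)[symmetric] pt_def by (simp add: scaleR_left_diff_distrib sum_subtractf)
    also have "\<dots> = t *\<^sub>R (u - w)"
      using t by (simp add: u_def w_def scaleR_diff_right scaleR_sum_right scaleR_left_diff_distrib sum_subtractf)
    finally have diff: "pt l - y = t *\<^sub>R (u - w)" .
    have "weights (\<lambda>i. n i / t)"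
      using t pn(4) tn by (auto simp: weights_def simp flip: sum_divide_distrib)
    from pt_in_S[OF this] have w: "w \<in> S" by (simp add: w_def pt_def)
    define F where "F = {z \<in> S. \<exists>e>0. w + e *\<^sub>R (w - z) \<in> S}"
    have F: "F face_of S"
      unfolding F_def by (rule face_of_extendable_points[OF convex_S w])
    have not_in_F: "v i \<notin> F" if i: "i \<in> {1..M}" and pi: "p i > 0" for i
    proof
      assume "v i \<in> F"
      then obtain e where e: "e > 0" "w + e *\<^sub>R (w - v i) \<in> S"
        by (auto simp: F_def)
      obtain \<theta> where \<theta>: "weights \<theta>" "pt \<theta> = w + e *\<^sub>R (w - v i)"
        using pt_surj[OF e(2)] .
      \<comment> \<open>With these values \<open>w\<close> is the convex combination of
        \<open>v i\<close> and the point \<open>pt \<theta>\<close>, which lies beyond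
        \<open>w\<close> as seen from \<open>v i\<close>.\<close>
      define a where "a = e / (1 + e)"
      define b where "b = 1 / (1 + e)"
      have ab: "a > 0" "b > 0" "a + b = 1"
        using e(1) by (auto simp: a_def b_def divide_simps)
      have "a *\<^sub>R v i + b *\<^sub>R pt \<theta> = (b * (1 + e)) *\<^sub>R w + (a - b * e) *\<^sub>R v i"
        unfolding \<theta>(2) by (simp add: algebra_simps)
      then have w_eq: "a *\<^sub>R v i + b *\<^sub>R pt \<theta> = w"
        using e(1) by (simp add: a_def b_def)
      \<comment> \<open>Small enough that at most the whole gain is rewritten and at most
        \<open>p i\<close> is returned to vertex \<open>i\<close>.\<close>
      define r where "r = min 1 (p i / (t * a))"
      have r: "0 < r" "r \<le> 1" "r * t * a \<le> p i"
        using t ab pi by (auto simp: r_def min_def field_simps)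
      define \<epsilon> where "\<epsilon> j = (if j = i then 1 else 0 :: real)" for j
      \<comment> \<open>A fraction \<open>r\<close> of the gain is replaced by weights with the same
        barycentre, of which \<open>r * t * a\<close> goes back to \<open>i\<close>. This would save
        \<open>2 * (r * t * a)\<close> in l1 distance, contradicting \<open>least\<close>.\<close>
      define m' where "m' j = m j - r * n j + r * t * a * \<epsilon> j + r * t * b * \<theta> j" for j
      have sum_\<epsilon>: "(\<Sum>j=1..M. \<epsilon> j) = 1"
        using i by (simp add: \<epsilon>_def)
      have "weights m'"
        unfolding weights_def
      proof (intro conjI ballI)
        fix j assume j: "j \<in> {1..M}"
        have "r * n j \<le> m j"
          using n_le[OF j] pn(4)[of j] r mult_left_le_one_le[of "n j" r] by linarith
        moreover have "0 \<le> r * t * a * \<epsilon> j" "0 \<le> r * t * b * \<theta> j"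
          using r t ab weights_nonneg[OF \<theta>(1) j] by (auto simp: \<epsilon>_def)
        ultimately show "0 \<le> m' j" by (simp add: m'_def)
      next
        have "(\<Sum>j=1..M. m' j) = 1 - r * t + r * t * a + r * t * b"
          by (simp add: m'_def sum.distrib sum_subtractf weights_sum m(1) \<theta>(1) tn sum_\<epsilon> flip: sum_distrib_left)
        also have "\<dots> = 1 - r * t + r * t * (a + b)" by (simp add: algebra_simps)
        finally show "(\<Sum>j=1..M. m' j) = 1" by (simp add: ab)
      qed
      moreover have "pt m' = y"
      proof -
        have "(\<Sum>j=1..M. (r * n j) *\<^sub>R v j) = (r * t) *\<^sub>R w"
          using t by (simp add: w_def scaleR_sum_right)
        moreover have "(\<Sum>j=1..M. (r * t * a * \<epsilon> j) *\<^sub>R v j) = (r * t * a) *\<^sub>R v i"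
        proof -
          have "(\<Sum>j=1..M. (r * t * a * \<epsilon> j) *\<^sub>R v j) = (\<Sum>j=1..M. if j = i then (r * t * a) *\<^sub>R v i else 0)"
            by (intro sum.cong) (auto simp: \<epsilon>_def)
          then show ?thesis using i by simp
        qed
        moreover have "(\<Sum>j=1..M. (r * t * b * \<theta> j) *\<^sub>R v j) = (r * t * b) *\<^sub>R pt \<theta>"
          by (simp add: pt_def scaleR_sum_right)
        ultimately have "pt m' = pt m - (r * t) *\<^sub>R w + (r * t * a) *\<^sub>R v i + (r * t * b) *\<^sub>R pt \<theta>"
          by (simp add: pt_def m'_def scaleR_add_left scaleR_diff_left sum.distrib sum_subtractf)
        also have "\<dots> = pt m - (r * t) *\<^sub>R w + (r * t) *\<^sub>R (a *\<^sub>R v i + b *\<^sub>R pt \<theta>)"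
          by (simp add: algebra_simps)
        finally show ?thesis by (simp add: w_eq m)
      qed
      ultimately have "2 * t \<le> (\<Sum>j=1..M. \<bar>l j - m' j\<bar>)"
        using least sum_abs by simp
      also have "\<dots> \<le> (\<Sum>j=1..M. (p j - r * t * a * \<epsilon> j) + (n j - r * n j) + r * t * b * \<theta> j)"
      proof (rule sum_mono)
        fix j assume j: "j \<in> {1..M}"
        have "l j - m' j = (p j - r * t * a * \<epsilon> j) - (n j - r * n j) - r * t * b * \<theta> j"
          using pn(1)[of j] by (simp add: m'_def)
        moreover have "0 \<le> p j - r * t * a * \<epsilon> j" "0 \<le> n j - r * n j" "0 \<le> r * t * b * \<theta> j"
          using r t ab weights_nonneg[OF \<theta>(1) j] pn(3,4)[of j] mult_left_le_one_le[of "n j" r]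
          by (auto simp: \<epsilon>_def)
        ultimately show "\<bar>l j - m' j\<bar> \<le> (p j - r * t * a * \<epsilon> j) + (n j - r * n j) + r * t * b * \<theta> j"
          by linarith
      qed
      also have "\<dots> = t - r * t * a + (t - r * t) + r * t * b"
        by (simp add: sum.distrib sum_subtractf weights_sum \<theta>(1) tn sum_\<epsilon> t_def[symmetric] flip: sum_distrib_left)
      also have "\<dots> = 2 * t - 2 * (r * t * a)"
      proof -
        have b: "b = 1 - a" using ab by simp
        show ?thesis unfolding b by (simp add: algebra_simps)
      qed
      finally have "r * t * a \<le> 0" by linarith
      moreover have "r * t * a > 0" using r t ab by simp
      ultimately show False by simp
    qed
    obtain i where i: "i \<in> {1..M}" "p i > 0"
    proof (rule ccontr)
      assume "\<not> thesis"
      then have "(\<Sum>i=1..M. p i) = 0" using that pn(3) by (intro sum.neutral) (metis less_eq_real_def)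
      then show False using t by (simp add: t_def)
    qed
    have "F \<noteq> S" using not_in_F[OF i] vertex_in_S[OF i(1)] by blast
    moreover have wF: "w \<in> F"
      using w by (auto simp: F_def intro: exI[of _ 1])
    ultimately have F_dist: "facial_distance S \<le> setdist F (convex hull (vertices S - F))"
      using F by (intro facial_distance_le) auto
    have "u \<in> convex hull (vertices S - F)"
    proof -
      \<comment> \<open>Indices with \<open>p i = 0\<close> are dropped, since their vertices may
        lie in \<open>F\<close>.\<close>
      define P where "P = {i \<in> {1..M}. p i > 0}"
      have fin: "finite P" by (simp add: P_def)
      have P: "(\<Sum>i=1..M. g i) = sum g P" if "\<And>i. p i = 0 \<Longrightarrow> g i = 0" for g :: "nat \<Rightarrow> 'b::real_vector"
        using that pn(3) unfolding P_def
        by (intro sum.mono_neutral_right) (auto simp: less_eq_real_def)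
      have "u = (\<Sum>i\<in>P. (p i / t) *\<^sub>R v i)"
        unfolding u_def by (rule P) simp
      moreover have "(\<Sum>i\<in>P. p i / t) = 1"
        using t P[of p] by (simp add: t_def flip: sum_divide_distrib)
      moreover have "v i \<in> convex hull (vertices S - F)" if "i \<in> P" for i
        using that not_in_F by (intro hull_inc) (auto simp: vertices_eq P_def)
      ultimately show ?thesis
        using fin t pn(3) by (auto intro!: convex_sum)
    qed
    then have "setdist F (convex hull (vertices S - F)) \<le> dist w u"
      by (rule setdist_le_dist[OF wF])
    with F_dist have "facial_distance S \<le> norm (u - w)"
      by (simp add: dist_norm norm_minus_commute)
    then show ?thesis
      using t by (simp add: diff mult.commute)
  qed simp
  then show ?thesis
    using that[OF m] sum_abs by simp
qed

end

section \<open>A sweep of the algorithm\<close>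

text \<open>One outer iteration with the step-size rule left open, so that what both rules share is
  proved once.\<close>

locale sweep = vertex_polytope S M v
  for S :: "'a::euclidean_space set" and M v +
  fixes f :: "'a \<Rightarrow> real" and L \<mu> :: real
    and x :: "nat \<Rightarrow> 'a" and w :: "nat \<Rightarrow> nat \<Rightarrow> real" and a :: "nat \<Rightarrow> real"
  assumes L_pos: "L > 0" and \<mu>_pos: "\<mu> > 0"
    and smooth: "smooth_on_set L S f" and strong: "strongly_convex_on_set \<mu> S f"
    and weights_0: "weights (w 0)" and x_0: "x 0 = pt (w 0)"
    and a_interval: "j \<in> {1..M} \<Longrightarrow> a j \<in> step_interval (w (j - 1) j)"
    and x_step: "j \<in> {1..M} \<Longrightarrow> x j = x (j - 1) + a j *\<^sub>R (v j - x (j - 1))"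
    and w_step: "j \<in> {1..M} \<Longrightarrow> i \<in> {1..M} \<Longrightarrow>
      w j i = (1 - a j) * w (j - 1) i + (if i = j then a j else 0)"
begin

abbreviation "D \<equiv> diameter S"
abbreviation "\<psi> \<equiv> facial_distance S"
abbreviation "r j \<equiv> v j - x (j - 1)"
abbreviation "g j \<equiv> gradient f (x j)"

lemma D_pos: "D > 0"
  using facial_distance_pos facial_distance_le_diameter by linarith

lemma a_le_1: "j \<in> {1..M} \<Longrightarrow> a j \<le> 1"
  using a_interval[of j] by (auto simp: step_interval_def split: if_splits)

lemma a_ge: "j \<in> {1..M} \<Longrightarrow> w (j - 1) j < 1 \<Longrightarrow> - w (j - 1) j \<le> a j * (1 - w (j - 1) j)"
  using a_interval[of j] by (auto simp: step_interval_def field_simps)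

text \<open>The left end of the step interval is the step that empties vertex \<open>j\<close>, so
  the weights stay in the simplex. If vertex \<open>j\<close> carries all the weight, no step
  changes it.\<close>

lemma weights_pt: "j \<le> M \<Longrightarrow> weights (w j) \<and> x j = pt (w j)"
proof (induction j)
  case 0
  then show ?case using weights_0 x_0 by simp
next
  case (Suc j)
  have j: "Suc j \<in> {1..M}" using Suc.prems by auto
  have IH: "weights (w j)" "x j = pt (w j)" using Suc by auto
  have step: "w (Suc j) i = (1 - a (Suc j)) * w j i + (if i = Suc j then a (Suc j) else 0)"
    if "i \<in> {1..M}" for i
    using w_step[OF j that] by simp
  have "weights (w (Suc j))"
    unfolding weights_def
  proof (intro conjI ballI)
    fix i assume i: "i \<in> {1..M}"
    have pos: "0 \<le> (1 - a (Suc j)) * w j i"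
      using a_le_1[OF j] weights_nonneg[OF IH(1) i] by simp
    show "0 \<le> w (Suc j) i"
    proof (cases "i = Suc j")
      case True
      have "0 \<le> w j i + a i * (1 - w j i)"
        using a_ge[OF j] weights_le_1[OF IH(1) i] True by (cases "w j i = 1") auto
      then show ?thesis using step[OF i] True by (simp add: algebra_simps)
    qed (use step[OF i] pos in simp)
  next
    have "(\<Sum>i=1..M. w (Suc j) i)
        = (\<Sum>i=1..M. (1 - a (Suc j)) * w j i + (if i = Suc j then a (Suc j) else 0))"
      by (intro sum.cong step) auto
    also have "\<dots> = (1 - a (Suc j)) * (\<Sum>i=1..M. w j i) + a (Suc j)"
      using j by (simp add: sum.distrib sum_distrib_left)
    finally show "(\<Sum>i=1..M. w (Suc j) i) = 1"
      by (simp add: weights_sum[OF IH(1)])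
  qed
  moreover have "x (Suc j) = pt (w (Suc j))"
  proof -
    have "pt (w (Suc j))
        = (\<Sum>i=1..M. (1 - a (Suc j)) *\<^sub>R (w j i *\<^sub>R v i) + (if i = Suc j then a (Suc j) *\<^sub>R v i else 0))"
      unfolding pt_def by (intro sum.cong) (auto simp: step scaleR_add_left)
    also have "\<dots> = (1 - a (Suc j)) *\<^sub>R pt (w j) + a (Suc j) *\<^sub>R v (Suc j)"
      using j by (simp add: sum.distrib pt_def scaleR_sum_right)
    also have "\<dots> = x (Suc j)"
      using x_step[OF j] by (simp add: IH(2) algebra_simps)
    finally show ?thesis by simp
  qed
  ultimately show ?case by blast
qed

lemma weights_w: "j \<le> M \<Longrightarrow> weights (w j)"
  and x_eq: "j \<le> M \<Longrightarrow> x j = pt (w j)"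
  using weights_pt by auto

lemma x_in_S: "j \<le> M \<Longrightarrow> x j \<in> S"
  using weights_pt pt_in_S by metis

lemma pred_le: "j \<in> {1..M} \<Longrightarrow> j - 1 \<le> M"
  by auto

lemma w_pred: "j \<in> {1..M} \<Longrightarrow> i \<in> {1..M} \<Longrightarrow> 0 \<le> w (j - 1) i \<and> w (j - 1) i \<le> 1"
  using weights_nonneg[OF weights_w[OF pred_le]] weights_le_1[OF weights_w[OF pred_le]] by blast

text \<open>Half the l1 change of the weights in step \<open>j\<close>. It is 0 if all weight sits
  on \<open>j\<close>, the case in which \<open>a j\<close> is unbounded below.\<close>

definition \<eta> :: "nat \<Rightarrow> real" where
  "\<eta> j = \<bar>a j\<bar> * (1 - w (j - 1) j)"

lemma \<eta>_nonneg: "j \<in> {1..M} \<Longrightarrow> \<eta> j \<ge> 0"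
  using w_pred[of j j] by (simp add: \<eta>_def)

lemma \<eta>_sum_mono: "k \<le> M \<Longrightarrow> (\<Sum>j=1..k. \<eta> j) \<le> (\<Sum>j=1..M. \<eta> j)"
  using \<eta>_nonneg by (intro sum_mono2) auto

lemma norm_step: "j \<in> {1..M} \<Longrightarrow> norm (x j - x (j - 1)) = \<bar>a j\<bar> * norm (r j)"
  using x_step[of j] by simp

lemma \<eta>_le_norm_step:
  assumes j: "j \<in> {1..M}" shows "\<psi> * \<eta> j \<le> norm (x j - x (j - 1))"
proof -
  have "\<psi> * (1 - w (j - 1) j) \<le> norm (r j)"
    using facial_distance_le_norm_vertex[OF weights_w[OF pred_le[OF j]] j] x_eq[OF pred_le[OF j]] by simp
  then have "\<bar>a j\<bar> * (\<psi> * (1 - w (j - 1) j)) \<le> \<bar>a j\<bar> * norm (r j)"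
    by (intro mult_left_mono) auto
  then show ?thesis
    by (simp only: norm_step[OF j] \<eta>_def mult.left_commute)
qed

lemma w_change:
  assumes j: "j \<in> {1..M}" and i: "i \<in> {1..M}"
  shows "\<bar>w j i - w (j - 1) i\<bar> \<le> \<eta> j"
proof (cases "i = j")
  case True
  have "w j j - w (j - 1) j = a j * (1 - w (j - 1) j)"
    using w_step[OF j j] by (simp add: algebra_simps)
  then show ?thesis
    using True w_pred[OF j j] by (simp add: \<eta>_def abs_mult)
next
  case False
  have "w j i - w (j - 1) i = - (a j * w (j - 1) i)"
    using w_step[OF j i] False by (simp add: algebra_simps)
  then have "\<bar>w j i - w (j - 1) i\<bar> = \<bar>a j\<bar> * w (j - 1) i"
    using w_pred[OF j i] by (simp add: abs_mult)
  also have "\<dots> \<le> \<eta> j"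
    unfolding \<eta>_def using weights_le_compl[OF weights_w[OF pred_le[OF j]] i j False]
    by (intro mult_left_mono) auto
  finally show ?thesis .
qed

lemma w_change_total:
  assumes i: "i \<in> {1..M}" and "k \<le> M"
  shows "\<bar>w k i - w 0 i\<bar> \<le> (\<Sum>j=1..k. \<eta> j)"
  using assms(2)
proof (induction k)
  case (Suc k)
  then have "Suc k \<in> {1..M}" by auto
  from w_change[OF this i] Suc show ?case by simp
qed simp

text \<open>Before its own turn a coordinate is only rescaled, by a factor common to all coordinates
  not yet processed.\<close>

lemma w_eq_prod:
  assumes i: "i \<in> {1..M}" shows "k < i \<Longrightarrow> w k i = (\<Prod>j=1..k. 1 - a j) * w 0 i"
proof (induction k)
  case (Suc k)
  then have "Suc k \<in> {1..M}" using i by auto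
  from w_step[OF this i] Suc show ?case by simp
qed simp

text \<open>After a total movement \<open>H\<close> every vertex still has mass at least
  \<open>\<beta> - H\<close> outside it. Hence a positive \<open>a (Suc k)\<close> costs at most
  \<open>\<eta> (Suc k)\<close> when \<open>\<beta> - H\<close> is multiplied by
  \<open>1 - a (Suc k)\<close>.\<close>

lemma prod_ge:
  assumes \<beta>: "\<And>i. i \<in> {1..M} \<Longrightarrow> \<beta> \<le> 1 - w 0 i" and small: "(\<Sum>j=1..M. \<eta> j) \<le> \<beta>" and "k \<le> M"
  shows "\<beta> - (\<Sum>j=1..k. \<eta> j) \<le> \<beta> * (\<Prod>j=1..k. 1 - a j)"
  using assms(3)
proof (induction k)
  case (Suc k)
  define H where "H = (\<Sum>j=1..k. \<eta> j)"
  have k: "Suc k \<in> {1..M}" "k \<le> M" using Suc.prems by auto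
  have H: "H \<le> \<beta>"
    using \<eta>_sum_mono[OF k(2)] small by (simp add: H_def)
  have "\<beta> - H \<le> 1 - w k (Suc k)"
    using w_change_total[OF k] \<beta>[OF k(1)] by (simp add: H_def)
  then have "a (Suc k) * (\<beta> - H) \<le> \<bar>a (Suc k)\<bar> * (1 - w k (Suc k))"
    using H by (intro mult_mono) auto
  then have "\<beta> - H - \<eta> (Suc k) \<le> (1 - a (Suc k)) * (\<beta> - H)"
    by (simp add: \<eta>_def algebra_simps)
  also have "\<dots> \<le> (1 - a (Suc k)) * (\<beta> * (\<Prod>j=1..k. 1 - a j))"
    using Suc.IH k a_le_1[OF k(1)] by (intro mult_left_mono) (auto simp: H_def)
  finally show ?case
    by (simp add: H_def mult_ac)
qed simp

lemma w_zero_stays: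
  assumes i: "i \<in> {1..M}" and "w i i = 0" and "i \<le> k" "k \<le> M"
  shows "w k i = 0"
  using assms(3,4)
proof (induction k rule: dec_induct)
  case (step k)
  then have "Suc k \<in> {1..M}" "Suc k \<noteq> i" by auto
  with w_step[OF this(1) i] step show ?case by simp
qed (rule assms(2))

lemma strong_lower_bound:
  "y \<in> S \<Longrightarrow> j \<le> M \<Longrightarrow> f y \<ge> f (x j) + g j \<bullet> (y - x j) + \<mu> / 2 * (norm (y - x j))\<^sup>2"
  using strong x_in_S[of j] unfolding strongly_convex_on_set_def by force

lemma lower_bound: "y \<in> S \<Longrightarrow> j \<le> M \<Longrightarrow> f y \<ge> f (x j) + g j \<bullet> (y - x j)"
  using strong_lower_bound[of y j] \<mu>_pos by (smt (verit) mult_nonneg_nonneg zero_le_power2 divide_nonneg_nonneg)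

lemma upper_bound:
  "y \<in> S \<Longrightarrow> j \<le> M \<Longrightarrow> f y \<le> f (x j) + g j \<bullet> (y - x j) + L / 2 * (norm (y - x j))\<^sup>2"
  by (rule smooth_upper_bound[OF convex_S smooth x_in_S])

text \<open>If all weight sits on \<open>j\<close>, the interval is unbounded, but then
  \<open>x (j - 1) = v j\<close>, so \<open>trivial\<close> gives \<open>d = 0\<close>. Otherwise
  the interval is compact.\<close>

lemma step_derivative_sign:
  assumes j: "j \<in> {1..M}"
    and min: "is_arg_min \<phi> (\<lambda>b. b \<in> step_interval (w (j - 1) j)) (a j)"
    and der: "(\<phi> has_field_derivative d) (at (a j))"
    and trivial: "r j = 0 \<Longrightarrow> d = 0"
  shows "d > 0 \<Longrightarrow> w (j - 1) j < 1 \<and> a j = - (w (j - 1) j / (1 - w (j - 1) j))"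
    and "d < 0 \<Longrightarrow> a j = 1"
proof -
  have "d = 0" if "w (j - 1) j = 1"
    using norm_diff_pt_le[OF weights_w[OF pred_le[OF j]] j] that x_eq[OF pred_le[OF j]]
    by (intro trivial) simp
  moreover have "is_arg_min \<phi> (\<lambda>b. b \<in> {- (w (j - 1) j / (1 - w (j - 1) j))..1}) (a j)"
    if "w (j - 1) j \<noteq> 1"
    using min that by (simp add: step_interval_def)
  ultimately show "d > 0 \<Longrightarrow> w (j - 1) j < 1 \<and> a j = - (w (j - 1) j / (1 - w (j - 1) j))"
    and "d < 0 \<Longrightarrow> a j = 1"
    using arg_min_interval_derivative[OF _ der] w_pred[OF j j]
    by (metis less_irrefl order_less_le)+
qed

lemma f_diff_telescope: "(\<Sum>j=1..M. f (x (j - 1)) - f (x j)) = f (x 0) - f (x M)"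
proof -
  have "(\<Sum>j=1..k. f (x (j - 1)) - f (x j)) = f (x 0) - f (x k)" for k
    by (induction k) auto
  then show ?thesis .
qed

end

section \<open>Transport of the optimality gap along a sweep\<close>

context sweep
begin

text \<open>Only the gradient change is tested against the vertex; the other term is the same for
  all \<open>i\<close>.\<close>

lemma vertex_gap_step:
  "g j \<bullet> (v i - x j) - g (j - 1) \<bullet> (v i - x (j - 1))
    = (g j - g (j - 1)) \<bullet> (v i - x (j - 1)) - g j \<bullet> (x j - x (j - 1))"
  by (simp add: algebra_simps)

lemma vertex_gap_telescope:
  "k \<le> l \<Longrightarrow> g l \<bullet> (v i - x l) = g k \<bullet> (v i - x k)
    + (\<Sum>j=Suc k..l. (g j - g (j - 1)) \<bullet> (v i - x (j - 1)) - g j \<bullet> (x j - x (j - 1)))"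
proof (induction l rule: dec_induct)
  case (step l)
  then show ?case
    using vertex_gap_step[of "Suc l" i] by simp
qed simp

text \<open>The coefficients \<open>w k i - m i\<close> sum to 0, so subtracting \<open>x k\<close>
  from every vertex is free.\<close>

lemma gap_decomposition:
  assumes "k \<le> M" "weights m"
  shows "g k \<bullet> (x k - pt m) = (\<Sum>i=1..M. (w k i - m i) * (g k \<bullet> (v i - x k)))"
proof -
  have "(\<Sum>i=1..M. (w k i - m i) *\<^sub>R (v i - x k)) = pt (w k) - pt m - (\<Sum>i=1..M. w k i - m i) *\<^sub>R x k"
    by (simp add: pt_def scaleR_sum_left sum_subtractf sum.distrib algebra_simps)
  also have "\<dots> = x k - pt m"
    using assms by (simp add: sum_subtractf weights_sum weights_w x_eq)
  finally have "g k \<bullet> (x k - pt m) = g k \<bullet> (\<Sum>i=1..M. (w k i - m i) *\<^sub>R (v i - x k))"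
    by simp
  then show ?thesis
    by (simp add: inner_sum_right)
qed

lemma norm_vertex_diff_le: "i \<in> {1..M} \<Longrightarrow> j \<le> M \<Longrightarrow> norm (v i - x j) \<le> D"
  by (intro dist_le_diameter vertex_in_S x_in_S)

lemma gradient_diff_le:
  "j \<in> {1..M} \<Longrightarrow> norm (g j - g (j - 1)) \<le> L * norm (x j - x (j - 1))"
  by (rule smooth_on_set_lipschitz[OF smooth x_in_S x_in_S]) auto

text \<open>Cauchy-Schwarz over the steps of a sweep brings in the factor \<open>M\<close>. The
  constant \<open>c\<close> will be \<open>L\<close> for gradient steps and \<open>\<mu>\<close> for
  line search.\<close>

lemma sum_norm_step_sq:
  assumes "c > 0"
    and "\<And>j. j \<in> {1..M} \<Longrightarrow> c / 2 * (norm (x j - x (j - 1)))\<^sup>2 \<le> f (x (j - 1)) - f (x j)"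
  shows "(\<Sum>j=1..M. norm (x j - x (j - 1)))\<^sup>2 \<le> 2 * real M * (f (x 0) - f (x M)) / c"
proof -
  have "c / 2 * (\<Sum>j=1..M. (norm (x j - x (j - 1)))\<^sup>2) \<le> f (x 0) - f (x M)"
    unfolding sum_distrib_left f_diff_telescope[symmetric] by (intro sum_mono assms(2))
  then have "(\<Sum>j=1..M. (norm (x j - x (j - 1)))\<^sup>2) \<le> 2 * (f (x 0) - f (x M)) / c"
    using assms(1) by (simp add: field_simps)
  then have "(\<Sum>j=1..M. (norm (x j - x (j - 1)))\<^sup>2) * real M \<le> 2 * (f (x 0) - f (x M)) / c * real M"
    by (intro mult_right_mono) auto
  then show ?thesis
    using sum_squared_le_sum_of_squares[of "\<lambda>j. norm (x j - x (j - 1))" "{1..M}"]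
    by (simp add: mult_ac)
qed

end

section \<open>Gradient steps\<close>

locale gradient_sweep = sweep +
  assumes gradient_step: "j \<in> {1..M} \<Longrightarrow> is_arg_min
    (\<lambda>b. b * (gradient f (x (j - 1)) \<bullet> (v j - x (j - 1))) + L * b\<^sup>2 / 2 * (norm (v j - x (j - 1)))\<^sup>2)
    (\<lambda>b. b \<in> step_interval (w (j - 1) j)) (a j)"
begin

text \<open>The derivative of the one-dimensional quadratic model at the chosen step.\<close>

definition d :: "nat \<Rightarrow> real" where
  "d j = g (j - 1) \<bullet> r j + L * a j * (norm (r j))\<^sup>2"

lemma d_sign:
  assumes j: "j \<in> {1..M}"
  shows "d j > 0 \<Longrightarrow> w (j - 1) j < 1 \<and> a j = - (w (j - 1) j / (1 - w (j - 1) j))"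
    and "d j < 0 \<Longrightarrow> a j = 1"
proof -
  have der: "((\<lambda>b. b * (g (j - 1) \<bullet> r j) + L * b\<^sup>2 / 2 * (norm (r j))\<^sup>2) has_field_derivative d j) (at (a j))"
    unfolding d_def by (auto intro!: derivative_eq_intros)
  have "r j = 0 \<Longrightarrow> d j = 0" by (simp add: d_def)
  from step_derivative_sign[OF j gradient_step[OF j] der this]
  show "d j > 0 \<Longrightarrow> w (j - 1) j < 1 \<and> a j = - (w (j - 1) j / (1 - w (j - 1) j))"
    and "d j < 0 \<Longrightarrow> a j = 1" by blast+
qed

lemma a_d_nonpos: "j \<in> {1..M} \<Longrightarrow> a j * d j \<le> 0"
  using d_sign[of j] w_pred[of j j]
  by (cases "d j" "0::real" rule: linorder_cases) (auto simp: mult_nonneg_nonneg)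

text \<open>A positive derivative forces the step that empties vertex \<open>j\<close>, and later
  steps only rescale its weight.\<close>

lemma w_zero_if_d_pos:
  assumes j: "j \<in> {1..M}" and "d j > 0" shows "w M j = 0"
proof -
  have *: "w (j - 1) j < 1" "a j = - (w (j - 1) j / (1 - w (j - 1) j))"
    using d_sign(1)[OF assms] by auto
  have "w j j = w (j - 1) j + a j * (1 - w (j - 1) j)"
    using w_step[OF j j] by (simp add: algebra_simps)
  also have "\<dots> = 0" using * by simp
  finally show ?thesis
    using w_zero_stays[OF j _ _ order_refl] j by auto
qed

lemma a_inner_eq:
  assumes "j \<in> {1..M}"
  shows "g (j - 1) \<bullet> (x j - x (j - 1)) = a j * d j - L * (norm (x j - x (j - 1)))\<^sup>2"
proof -
  have "x j - x (j - 1) = a j *\<^sub>R r j" using x_step[OF assms] by simp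
  then show ?thesis
    by (simp only: d_def norm_scaleR inner_scaleR_right power_mult_distrib power2_abs)
      (simp add: power2_eq_square ring_distribs mult_ac)
qed

lemma norm_step_sq_le:
  assumes j: "j \<in> {1..M}"
  shows "L / 2 * (norm (x j - x (j - 1)))\<^sup>2 \<le> f (x (j - 1)) - f (x j)"
  using upper_bound[OF x_in_S pred_le[OF j], of j] a_inner_eq[OF j] a_d_nonpos[OF j] j by auto

text \<open>The first bound is convexity at \<open>x j\<close>. For the second, the gradient change
  contributes at most \<open>L\<close> times the squared step, which is exactly the curvature term
  in \<open>a_inner_eq\<close>.\<close>

lemma inner_step_bounds:
  assumes j: "j \<in> {1..M}"
  shows "- (f (x (j - 1)) - f (x j)) \<le> g j \<bullet> (x j - x (j - 1))"
    and "g j \<bullet> (x j - x (j - 1)) \<le> 0"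
proof -
  show "- (f (x (j - 1)) - f (x j)) \<le> g j \<bullet> (x j - x (j - 1))"
    using lower_bound[OF x_in_S[OF pred_le[OF j]], of j] j by (simp add: inner_diff_right)
  have "(g j - g (j - 1)) \<bullet> (x j - x (j - 1)) \<le> norm (g j - g (j - 1)) * norm (x j - x (j - 1))"
    by (rule norm_cauchy_schwarz)
  also have "\<dots> \<le> L * norm (x j - x (j - 1)) * norm (x j - x (j - 1))"
    by (intro mult_right_mono gradient_diff_le[OF j]) auto
  finally have "(g j - g (j - 1)) \<bullet> (x j - x (j - 1)) \<le> L * (norm (x j - x (j - 1)))\<^sup>2"
    by (simp add: power2_eq_square mult.assoc)
  then show "g j \<bullet> (x j - x (j - 1)) \<le> 0"
    using a_inner_eq[OF j] a_d_nonpos[OF j] by (simp add: inner_diff_left)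
qed

abbreviation "Z \<equiv> (\<Sum>j=1..M. norm (x j - x (j - 1)))"

lemma f_decrease: "0 \<le> f (x 0) - f (x M)"
  unfolding f_diff_telescope[symmetric]
  using inner_step_bounds by (intro sum_nonneg) force

text \<open>The \<open>d i\<close> term has a favourable sign: either \<open>w M i = 0\<close>, or
  \<open>a i = 1\<close>, or \<open>d i = 0\<close>. What remains is the gradient change and the
  model curvature, each at most \<open>L * D\<close> times the step length.\<close>

lemma own_gap_le:
  assumes i: "i \<in> {1..M}" and "m \<ge> 0"
  shows "(w M i - m) * (g i \<bullet> (v i - x i))
    \<le> \<bar>w M i - m\<bar> * (2 * L * D * norm (x i - x (i - 1)))"
proof -
  define \<delta> where "\<delta> = w M i - m"
  define N where "N = norm (x i - x (i - 1))"
  have vx: "v i - x i = (1 - a i) *\<^sub>R r i"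
    using x_step[OF i] by (simp add: algebra_simps)
  have xx: "x i - x (i - 1) = a i *\<^sub>R r i"
    using x_step[OF i] by simp
  have eq: "g i \<bullet> (v i - x i) = (1 - a i) * d i + (g i - g (i - 1)) \<bullet> (v i - x i)
      - L * (((x i - x (i - 1)) \<bullet> (v i - x i)))"
    unfolding vx xx d_def
    by (simp add: inner_diff_left[of "g i"] power2_norm_eq_inner ring_distribs mult_ac)
  have sign: "\<delta> * ((1 - a i) * d i) \<le> 0"
  proof (cases "d i > 0")
    case True
    then have "\<delta> \<le> 0" using w_zero_if_d_pos[OF i] assms(2) by (simp add: \<delta>_def)
    moreover have "(1 - a i) * d i \<ge> 0" using True a_le_1[OF i] by simp
    ultimately show ?thesis by (rule mult_nonpos_nonneg)
  next
    case False
    then have "(1 - a i) * d i = 0" using d_sign(2)[OF i] by (cases "d i = 0") auto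
    then show ?thesis by (simp only: mult_zero_right order_refl)
  qed
  have vD: "norm (v i - x i) \<le> D" using norm_vertex_diff_le[OF i] i by simp
  have "\<bar>(g i - g (i - 1)) \<bullet> (v i - x i)\<bar> \<le> norm (g i - g (i - 1)) * norm (v i - x i)"
    by (rule Cauchy_Schwarz_ineq2)
  also have "\<dots> \<le> (L * N) * D"
    unfolding N_def using gradient_diff_le[OF i] vD L_pos by (intro mult_mono) auto
  finally have 1: "\<bar>(g i - g (i - 1)) \<bullet> (v i - x i)\<bar> \<le> (L * N) * D" .
  have "\<bar>(x i - x (i - 1)) \<bullet> (v i - x i)\<bar> \<le> N * norm (v i - x i)"
    unfolding N_def by (rule Cauchy_Schwarz_ineq2)
  also have "\<dots> \<le> N * D"
    using vD by (intro mult_left_mono) (auto simp: N_def)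
  finally have 2: "\<bar>L * ((x i - x (i - 1)) \<bullet> (v i - x i))\<bar> \<le> L * (N * D)"
    using L_pos by (simp add: abs_mult)
  define R where "R = (g i - g (i - 1)) \<bullet> (v i - x i) - L * ((x i - x (i - 1)) \<bullet> (v i - x i))"
  have "\<bar>R\<bar> \<le> 2 * L * D * N"
    using 1 2 by (simp add: R_def abs_le_iff mult_ac)
  then have "\<bar>\<delta>\<bar> * \<bar>R\<bar> \<le> \<bar>\<delta>\<bar> * (2 * L * D * N)"
    by (rule mult_left_mono) simp
  then have "\<delta> * R \<le> \<bar>\<delta>\<bar> * (2 * L * D * N)"
    using abs_ge_self[of "\<delta> * R"] unfolding abs_mult by linarith
  moreover have "g i \<bullet> (v i - x i) = (1 - a i) * d i + R"
    using eq by (simp add: R_def)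
  ultimately show ?thesis
    using sign by (simp only: \<delta>_def[symmetric] N_def[symmetric] distrib_left)
qed

text \<open>The gap is moved from \<open>x i\<close> to \<open>x M\<close>. The vertex-independent
  terms \<open>- e j\<close> are nonnegative and sum to at most the decrease; keeping
  \<open>w M i\<close> as their coefficient makes them cost one full decrease after summing over
  \<open>i\<close>.\<close>

lemma vertex_gap_le:
  assumes i: "i \<in> {1..M}" and m: "m \<ge> 0"
  shows "(w M i - m) * (g M \<bullet> (v i - x M))
    \<le> w M i * (f (x 0) - f (x M)) + \<bar>w M i - m\<bar> * (2 * L * D * Z)"
proof -
  define \<delta> where "\<delta> = w M i - m"
  define \<Delta> where "\<Delta> j = f (x (j - 1)) - f (x j)" for j
  define q where "q j = (g j - g (j - 1)) \<bullet> (v i - x (j - 1))" for j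
  define e where "e j = g j \<bullet> (x j - x (j - 1))" for j
  define N where "N j = norm (x j - x (j - 1))" for j
  let ?J = "{Suc i..M}"
  have J: "j \<in> {1..M}" if "j \<in> ?J" for j using that i by auto
  have wi: "w M i \<ge> 0" using weights_nonneg[OF weights_w i] by simp
  have \<Delta>_nonneg: "\<Delta> j \<ge> 0" if "j \<in> {1..M}" for j
    using inner_step_bounds[OF that] by (simp add: \<Delta>_def)
  have "\<bar>q j\<bar> \<le> L * D * N j" if "j \<in> ?J" for j
  proof -
    have "\<bar>q j\<bar> \<le> norm (g j - g (j - 1)) * norm (v i - x (j - 1))"
      unfolding q_def by (rule Cauchy_Schwarz_ineq2)
    also have "\<dots> \<le> (L * N j) * D"
      unfolding N_def using gradient_diff_le[OF J[OF that]] norm_vertex_diff_le[OF i pred_le[OF J[OF that]]] L_pos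
      by (intro mult_mono) auto
    finally show ?thesis by (simp add: mult_ac)
  qed
  then have "\<bar>\<Sum>j\<in>?J. q j\<bar> \<le> (\<Sum>j\<in>?J. L * D * N j)"
    by (rule order_trans[OF sum_abs sum_mono])
  then have "\<bar>\<delta>\<bar> * \<bar>\<Sum>j\<in>?J. q j\<bar> \<le> \<bar>\<delta>\<bar> * (L * D * (\<Sum>j\<in>?J. N j))"
    by (intro mult_left_mono) (auto simp: sum_distrib_left)
  then have q: "\<delta> * (\<Sum>j\<in>?J. q j) \<le> \<bar>\<delta>\<bar> * (L * D * (\<Sum>j\<in>?J. N j))"
    using abs_ge_self[of "\<delta> * (\<Sum>j\<in>?J. q j)"] unfolding abs_mult by linarith
  have e1: "- e j \<le> \<Delta> j" and e2: "e j \<le> 0" if "j \<in> ?J" for j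
    using inner_step_bounds[OF J[OF that]] by (auto simp: e_def \<Delta>_def)
  have "(\<Sum>j\<in>?J. - e j) \<le> (\<Sum>j\<in>?J. \<Delta> j)"
    by (intro sum_mono e1)
  also have "\<dots> \<le> (\<Sum>j=1..M. \<Delta> j)"
    by (intro sum_mono2) (auto intro: \<Delta>_nonneg)
  finally have E: "0 \<le> (\<Sum>j\<in>?J. - e j)" "(\<Sum>j\<in>?J. - e j) \<le> f (x 0) - f (x M)"
    using e2 by (auto simp: \<Delta>_def f_diff_telescope intro!: sum_nonneg)
  have "\<delta> * (\<Sum>j\<in>?J. - e j) \<le> w M i * (\<Sum>j\<in>?J. - e j)"
    using E m by (intro mult_right_mono) (auto simp: \<delta>_def)
  also have "\<dots> \<le> w M i * (f (x 0) - f (x M))"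
    using E wi by (intro mult_left_mono)
  finally have e: "\<delta> * (\<Sum>j\<in>?J. - e j) \<le> w M i * (f (x 0) - f (x M))" .
  have "g M \<bullet> (v i - x M) = g i \<bullet> (v i - x i) + (\<Sum>j\<in>?J. q j) + (\<Sum>j\<in>?J. - e j)"
    using vertex_gap_telescope[of i M i] i by (simp add: q_def e_def sum_subtractf sum_negf)
  then have "\<delta> * (g M \<bullet> (v i - x M)) = \<delta> * (g i \<bullet> (v i - x i)) + \<delta> * (\<Sum>j\<in>?J. q j) + \<delta> * (\<Sum>j\<in>?J. - e j)"
    by (simp add: distrib_left)
  also have "\<dots> \<le> \<bar>\<delta>\<bar> * (2 * L * D * N i) + \<bar>\<delta>\<bar> * (L * D * (\<Sum>j\<in>?J. N j)) + w M i * (f (x 0) - f (x M))"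
    using own_gap_le[OF i m] q e unfolding \<delta>_def N_def by linarith
  also have "\<dots> \<le> \<bar>\<delta>\<bar> * (2 * L * D * Z) + w M i * (f (x 0) - f (x M))"
  proof -
    have "N i + (\<Sum>j\<in>?J. N j) = (\<Sum>j=i..M. N j)"
      using i by (simp add: sum.atLeast_Suc_atMost[of i M])
    also have "\<dots> \<le> Z"
      unfolding N_def using i by (intro sum_mono2) auto
    finally have NZ: "N i + (\<Sum>j\<in>?J. N j) \<le> Z" .
    have "(\<Sum>j\<in>?J. N j) \<ge> 0" by (intro sum_nonneg) (simp add: N_def)
    with NZ have "2 * N i + (\<Sum>j\<in>?J. N j) \<le> 2 * Z" by linarith
    then have "(\<bar>\<delta>\<bar> * (L * D)) * (2 * N i + (\<Sum>j\<in>?J. N j)) \<le> (\<bar>\<delta>\<bar> * (L * D)) * (2 * Z)"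
      using L_pos D_pos by (intro mult_left_mono) auto
    then show ?thesis by (simp add: algebra_simps)
  qed
  finally show ?thesis by (simp add: \<delta>_def)
qed

lemma gradient_sweep_progress:
  assumes y: "y \<in> S"
  shows "f (x M) - f y \<le> (1 + 16 * real M * L * D\<^sup>2 / (\<mu> * \<psi>\<^sup>2)) * (f (x 0) - f (x M))"
proof -
  define \<Delta> where "\<Delta> = f (x 0) - f (x M)"
  define \<rho> where "\<rho> = norm (x M - y)"
  obtain m where m: "weights m" "pt m = y"
    and err: "\<psi> * (\<Sum>i=1..M. \<bar>w M i - m i\<bar>) \<le> 2 * \<rho>"
    using weights_error_bound[OF weights_w[OF order_refl] y] x_eq[OF order_refl] by (metis \<rho>_def)
  let ?\<delta> = "\<Sum>i=1..M. \<bar>w M i - m i\<bar>"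
  have \<psi>: "\<psi> > 0" by (rule facial_distance_pos)
  have Z: "Z \<ge> 0" by (intro sum_nonneg) simp
  have "g M \<bullet> (x M - y) = (\<Sum>i=1..M. (w M i - m i) * (g M \<bullet> (v i - x M)))"
    using gap_decomposition[OF order_refl m(1)] m(2) by simp
  also have "\<dots> \<le> (\<Sum>i=1..M. w M i * \<Delta> + \<bar>w M i - m i\<bar> * (2 * L * D * Z))"
    unfolding \<Delta>_def by (intro sum_mono vertex_gap_le weights_nonneg[OF m(1)])
  also have "\<dots> = \<Delta> + ?\<delta> * (2 * L * D * Z)"
    by (simp add: sum.distrib weights_sum weights_w flip: sum_distrib_right)
  also have "?\<delta> * (2 * L * D * Z) \<le> (2 * \<rho> / \<psi>) * (2 * L * D * Z)"
    using err \<psi> L_pos D_pos Z by (intro mult_right_mono) (auto simp: field_simps)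
  also have "\<dots> \<le> \<mu> / 2 * \<rho>\<^sup>2 + 8 * L\<^sup>2 * D\<^sup>2 * Z\<^sup>2 / (\<mu> * \<psi>\<^sup>2)"
  proof -
    \<comment> \<open>Completing the square leaves a multiple of \<open>\<rho>\<^sup>2\<close> that
      strong convexity gives back exactly.\<close>
    have "0 \<le> (\<mu> * \<rho> - 4 * L * D * Z / \<psi>)\<^sup>2 / (2 * \<mu>)"
      using \<mu>_pos by simp
    also have "\<dots> = \<mu> / 2 * \<rho>\<^sup>2 + 8 * L\<^sup>2 * D\<^sup>2 * Z\<^sup>2 / (\<mu> * \<psi>\<^sup>2) - (2 * \<rho> / \<psi>) * (2 * L * D * Z)"
      using \<mu>_pos \<psi> by (simp add: field_simps power2_eq_square)
    finally show ?thesis by simp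
  qed
  also have "8 * L\<^sup>2 * D\<^sup>2 * Z\<^sup>2 / (\<mu> * \<psi>\<^sup>2) \<le> 16 * real M * L * D\<^sup>2 / (\<mu> * \<psi>\<^sup>2) * \<Delta>"
  proof -
    \<comment> \<open>The squared path length is at most \<open>2 * M * \<Delta> / L\<close>: this
      cancels one \<open>L\<close> and turns 8 into 16.\<close>
    have "(8 * L\<^sup>2 * D\<^sup>2 / (\<mu> * \<psi>\<^sup>2)) * Z\<^sup>2 \<le> (8 * L\<^sup>2 * D\<^sup>2 / (\<mu> * \<psi>\<^sup>2)) * (2 * real M * \<Delta> / L)"
      unfolding \<Delta>_def using \<mu>_pos
      by (intro mult_left_mono sum_norm_step_sq[OF L_pos norm_step_sq_le]) auto
    then show ?thesis using L_pos by (simp add: power2_eq_square mult_ac)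
  qed
  finally have "g M \<bullet> (x M - y) \<le> \<Delta> + (\<mu> / 2 * \<rho>\<^sup>2 + 16 * real M * L * D\<^sup>2 / (\<mu> * \<psi>\<^sup>2) * \<Delta>)"
    by simp
  moreover have "f (x M) - f y \<le> g M \<bullet> (x M - y) - \<mu> / 2 * \<rho>\<^sup>2"
    using strong_lower_bound[OF y order_refl] by (simp add: \<rho>_def norm_minus_commute inner_diff_right)
  ultimately show ?thesis
    by (simp add: \<Delta>_def[symmetric] distrib_right)
qed

end

section \<open>Exact line search\<close>

locale line_search_sweep = sweep +
  assumes line_search: "j \<in> {1..M} \<Longrightarrow> is_arg_min
    (\<lambda>b. f (x (j - 1) + b *\<^sub>R (v j - x (j - 1)))) (\<lambda>b. b \<in> step_interval (w (j - 1) j)) (a j)"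
begin

text \<open>The derivative of \<open>f\<close> along the search line at the chosen step.\<close>

definition d :: "nat \<Rightarrow> real" where
  "d j = g j \<bullet> r j"

lemma d_sign:
  assumes j: "j \<in> {1..M}"
  shows "d j > 0 \<Longrightarrow> w (j - 1) j < 1 \<and> a j = - (w (j - 1) j / (1 - w (j - 1) j))"
    and "d j < 0 \<Longrightarrow> a j = 1"
proof -
  have xj: "x (j - 1) + a j *\<^sub>R r j = x j" using x_step[OF j] by simp
  have "f differentiable (at (x j))"
    using smooth x_in_S[of j] j by (auto simp: smooth_on_set_def)
  then have der: "((\<lambda>b. f (x (j - 1) + b *\<^sub>R r j)) has_field_derivative d j) (at (a j))"
    using DERIV_along_line[of f "x (j - 1)" "a j" "r j"] by (simp only: xj d_def)
  have "r j = 0 \<Longrightarrow> d j = 0" by (simp add: d_def)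
  from step_derivative_sign[OF j line_search[OF j] der this]
  show "d j > 0 \<Longrightarrow> w (j - 1) j < 1 \<and> a j = - (w (j - 1) j / (1 - w (j - 1) j))"
    and "d j < 0 \<Longrightarrow> a j = 1" by blast+
qed

lemma a_d_nonpos: "j \<in> {1..M} \<Longrightarrow> a j * d j \<le> 0"
  using d_sign[of j] w_pred[of j j]
  by (cases "d j" "0::real" rule: linorder_cases) (auto simp: mult_nonneg_nonneg)

lemma inner_step_eq: "j \<in> {1..M} \<Longrightarrow> g j \<bullet> (x j - x (j - 1)) = a j * d j"
  using x_step[of j] by (simp add: d_def)

lemma norm_step_sq_le:
  assumes j: "j \<in> {1..M}"
  shows "\<mu> / 2 * (norm (x j - x (j - 1)))\<^sup>2 \<le> f (x (j - 1)) - f (x j)"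
  using strong_lower_bound[OF x_in_S[OF pred_le[OF j]], of j] inner_step_eq[OF j] a_d_nonpos[OF j] j
  by (simp add: inner_diff_right norm_minus_commute)

text \<open>On \<open>S\<close> the function \<open>f\<close> need not satisfy the cocoercivity inequality for \<open>L\<close>-smooth functions.
  Its substitute is to test smoothness at \<open>x (j - 1)\<close> and convexity at \<open>x j\<close> against
  \<open>x (j - 1) + s *\<^sub>R u\<close>, which has to stay in \<open>S\<close>.\<close>

lemma single_step_bound:
  fixes \<delta> :: "nat \<Rightarrow> real"
  defines "T \<equiv> \<lambda>j. \<Sum>i=j..M. \<delta> i"
    and "u \<equiv> \<lambda>j. \<Sum>i=j..M. \<delta> i *\<^sub>R (x (j - 1) - v i)"
  assumes j: "j \<in> {1..M}" and T: "1 + s * T j \<ge> 0"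
    and feasible: "\<And>l. l \<in> {j..M} \<Longrightarrow> s * \<delta> l \<le> w (j - 1) l * (1 + s * T j)"
  shows "s * (\<delta> j * ((1 - a j) * d j) + T j * (a j * d j) - (g (j - 1) - g j) \<bullet> u j)
    \<le> f (x (j - 1)) - f (x j) + L / 2 * s\<^sup>2 * (norm (u j))\<^sup>2"
proof -
  define y where "y = x (j - 1) + s *\<^sub>R u j"
  have tail: "(\<Sum>i=1..M. if j \<le> i then h i else 0) = (\<Sum>i=j..M. h i)" for h :: "nat \<Rightarrow> 'b::comm_monoid_add"
    using j by (intro sum.mono_neutral_cong_right) auto
  \<comment> \<open>The weights of \<open>y\<close>: \<open>u j\<close> is \<open>T j\<close> times
    \<open>x (j - 1)\<close> minus the \<open>\<delta>\<close>-combination of the vertices from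
    \<open>j\<close> on. Nonnegativity follows from \<open>feasible\<close> for
    \<open>l \<ge> j\<close> and from \<open>T\<close> for smaller \<open>l\<close>.\<close>
  define m where "m l = w (j - 1) l * (1 + s * T j) - (if j \<le> l then s * \<delta> l else 0)" for l
  have wj: "weights (w (j - 1))" "x (j - 1) = pt (w (j - 1))"
    using weights_w x_eq pred_le[OF j] by auto
  have "weights m"
    unfolding weights_def
  proof (intro conjI ballI)
    show "0 \<le> m l" if "l \<in> {1..M}" for l
      using feasible[of l] that T weights_nonneg[OF wj(1) that] by (auto simp: m_def)
    show "(\<Sum>l=1..M. m l) = 1"
      by (simp add: m_def sum_subtractf tail weights_sum[OF wj(1)] T_def flip: sum_distrib_left sum_distrib_right)
  qed
  moreover have "pt m = y"
  proof -
    have "pt m = (\<Sum>l=1..M. (1 + s * T j) *\<^sub>R (w (j - 1) l *\<^sub>R v l) - (if j \<le> l then s *\<^sub>R (\<delta> l *\<^sub>R v l) else 0))"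
      unfolding pt_def by (intro sum.cong) (auto simp: m_def scaleR_diff_left mult.commute)
    also have "\<dots> = (1 + s * T j) *\<^sub>R x (j - 1) - s *\<^sub>R (\<Sum>l=j..M. \<delta> l *\<^sub>R v l)"
      by (simp add: sum_subtractf tail wj(2) pt_def scaleR_sum_right)
    also have "\<dots> = y"
      by (simp add: y_def u_def T_def scaleR_diff_right sum_subtractf algebra_simps flip: scaleR_sum_left)
    finally show ?thesis .
  qed
  ultimately have y: "y \<in> S" using pt_in_S by metis
  have "f y \<le> f (x (j - 1)) + s * (g (j - 1) \<bullet> u j) + L / 2 * (s\<^sup>2 * (norm (u j))\<^sup>2)"
    using upper_bound[OF y pred_le[OF j]] by (simp add: y_def power_mult_distrib)
  moreover have "f y \<ge> f (x j) + g j \<bullet> (y - x j)"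
    using lower_bound[OF y] j by simp
  moreover have "g j \<bullet> (y - x j) = s * (g j \<bullet> u j) - a j * d j"
    using inner_step_eq[OF j] by (simp add: y_def inner_add_right inner_diff_right)
  ultimately have "- (s * ((g (j - 1) - g j) \<bullet> u j))
      \<le> f (x (j - 1)) - f (x j) + a j * d j + L / 2 * s\<^sup>2 * (norm (u j))\<^sup>2"
    by (simp add: inner_diff_left right_diff_distrib)
  \<comment> \<open>If \<open>d j < 0\<close>, then \<open>a j = 1\<close> and the factor is
    \<open>1 + s * T j\<close>. If \<open>d j > 0\<close>, the step empties vertex \<open>j\<close>
    and the factor is nonpositive precisely by feasibility in coordinate \<open>j\<close>.\<close>
  moreover have "(s * \<delta> j * (1 - a j) + s * T j * a j + a j) * d j \<le> 0"
  proof (cases "d j" "0::real" rule: linorder_cases)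
    case less
    then have "a j = 1" by (rule d_sign(2)[OF j])
    then show ?thesis using T less by (simp add: mult_nonneg_nonpos add.commute)
  next
    case greater
    define \<omega> where "\<omega> = w (j - 1) j"
    have \<omega>: "\<omega> < 1" "a j = - (\<omega> / (1 - \<omega>))"
      using d_sign(1)[OF j greater] by (auto simp: \<omega>_def)
    define \<kappa> where "\<kappa> = 1 / (1 - \<omega>)"
    have "\<kappa> \<ge> 0" "a j = - (\<omega> * \<kappa>)" "1 - a j = \<kappa>"
      using \<omega> by (auto simp: \<kappa>_def field_simps)
    then have "s * \<delta> j * (1 - a j) + s * T j * a j + a j = \<kappa> * (s * \<delta> j - \<omega> * (1 + s * T j))"
      by (simp only:) (simp add: algebra_simps)
    also have "\<dots> \<le> 0"
      using feasible[of j] j \<open>\<kappa> \<ge> 0\<close> by (intro mult_nonneg_nonpos) (auto simp: \<omega>_def)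
    finally show ?thesis
      using greater by (intro mult_nonpos_nonneg) auto
  qed simp
  ultimately show ?thesis
    by (simp only: ring_distribs mult_ac)
qed

text \<open>The gap at vertex \<open>i\<close> is traced back from \<open>x i\<close>, where it
  equals \<open>(1 - a i) * d i\<close>, to \<open>x 0\<close>. Exchanging the sums groups the terms
  by step, so that each gradient change meets the single vector \<open>u j\<close>.\<close>

lemma sweep_bound:
  fixes \<delta> :: "nat \<Rightarrow> real"
  defines "T \<equiv> \<lambda>j. \<Sum>i=j..M. \<delta> i"
    and "u \<equiv> \<lambda>j. \<Sum>i=j..M. \<delta> i *\<^sub>R (x (j - 1) - v i)"
  assumes T: "\<And>j. j \<in> {1..M} \<Longrightarrow> 1 + s * T j \<ge> 0"
    and feasible: "\<And>j l. j \<in> {1..M} \<Longrightarrow> l \<in> {j..M} \<Longrightarrow> s * \<delta> l \<le> w (j - 1) l * (1 + s * T j)"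
    and U: "\<And>j. j \<in> {1..M} \<Longrightarrow> norm (u j) \<le> U"
  shows "s * (\<Sum>i=1..M. \<delta> i * (g 0 \<bullet> (v i - x 0))) \<le> f (x 0) - f (x M) + real M * L / 2 * s\<^sup>2 * U\<^sup>2"
proof -
  let ?q = "\<lambda>i j. (g j - g (j - 1)) \<bullet> (v i - x (j - 1))"
  have gap: "g 0 \<bullet> (v i - x 0) = (1 - a i) * d i + (\<Sum>j=1..i. a j * d j - ?q i j)" if i: "i \<in> {1..M}" for i
  proof -
    have "v i - x i = (1 - a i) *\<^sub>R r i"
      using x_step[OF i] by (simp add: algebra_simps)
    then have "g i \<bullet> (v i - x i) = (1 - a i) * d i"
      by (simp add: d_def)
    moreover have "(\<Sum>j=1..i. ?q i j - g j \<bullet> (x j - x (j - 1))) = (\<Sum>j=1..i. ?q i j - a j * d j)"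
      using i by (intro sum.cong) (auto simp: inner_step_eq)
    ultimately show ?thesis
      using vertex_gap_telescope[of 0 i i] by (simp add: sum_subtractf One_nat_def[symmetric])
  qed
  have "(\<Sum>i=1..M. \<delta> i * (g 0 \<bullet> (v i - x 0)))
      = (\<Sum>i=1..M. \<delta> i * ((1 - a i) * d i)) + (\<Sum>i=1..M. \<Sum>j=1..i. \<delta> i * (a j * d j - ?q i j))"
    by (simp add: gap distrib_left sum.distrib sum_distrib_left)
  also have "\<dots> = (\<Sum>j=1..M. \<delta> j * ((1 - a j) * d j) + (\<Sum>i=j..M. \<delta> i * (a j * d j - ?q i j)))"
    by (simp only: sum_nested_triangle sum.distrib)
  also have "\<dots> = (\<Sum>j=1..M. \<delta> j * ((1 - a j) * d j) + T j * (a j * d j) - (g (j - 1) - g j) \<bullet> u j)"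
  proof (intro sum.cong refl)
    fix j
    have "\<delta> i * ?q i j = (g (j - 1) - g j) \<bullet> (\<delta> i *\<^sub>R (x (j - 1) - v i))" for i
      by (simp add: algebra_simps)
    then have "(\<Sum>i=j..M. \<delta> i * ?q i j) = (g (j - 1) - g j) \<bullet> u j"
      by (simp only: u_def inner_sum_right)
    then show "\<delta> j * ((1 - a j) * d j) + (\<Sum>i=j..M. \<delta> i * (a j * d j - ?q i j))
        = \<delta> j * ((1 - a j) * d j) + T j * (a j * d j) - (g (j - 1) - g j) \<bullet> u j"
      by (simp add: T_def right_diff_distrib sum_subtractf flip: sum_distrib_right)
  qed
  also have "s * \<dots> \<le> (\<Sum>j=1..M. (f (x (j - 1)) - f (x j)) + L / 2 * s\<^sup>2 * U\<^sup>2)"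
    unfolding sum_distrib_left
  proof (intro sum_mono)
    fix j assume j: "j \<in> {1..M}"
    have "s * (\<delta> j * ((1 - a j) * d j) + T j * (a j * d j) - (g (j - 1) - g j) \<bullet> u j)
        \<le> f (x (j - 1)) - f (x j) + L / 2 * s\<^sup>2 * (norm (u j))\<^sup>2"
      using single_step_bound[OF j, of s \<delta>] T[OF j] feasible[OF j] by (simp only: T_def u_def)
    also have "\<dots> \<le> f (x (j - 1)) - f (x j) + L / 2 * s\<^sup>2 * U\<^sup>2"
      using U[OF j] L_pos by (intro add_left_mono mult_left_mono power_mono) auto
    finally show "s * (\<delta> j * ((1 - a j) * d j) + T j * (a j * d j) - (g (j - 1) - g j) \<bullet> u j)
        \<le> f (x (j - 1)) - f (x j) + L / 2 * s\<^sup>2 * U\<^sup>2" .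
  qed
  finally show ?thesis
    by (simp only: sum.distrib f_diff_telescope) (simp add: mult_ac)
qed

end

section \<open>Constants of the line search estimate\<close>

context sweep
begin

lemma \<mu>_le_L: "\<mu> \<le> L"
proof -
  have i: "1 \<in> {1..M}" "2 \<in> {1..M}" using two_vertices by auto
  have "v 1 \<noteq> v 2" using inj_onD[OF inj_v _ i] by auto
  then obtain y where y: "y \<in> S" "y \<noteq> x 0"
    using vertex_in_S[OF i(1)] vertex_in_S[OF i(2)] by metis
  have "\<mu> / 2 * (norm (y - x 0))\<^sup>2 \<le> L / 2 * (norm (y - x 0))\<^sup>2"
    using strong_lower_bound[OF y(1), of 0] upper_bound[OF y(1), of 0] by linarith
  then show ?thesis using y(2) by simp
qed

text \<open>Bounds \<open>s\<^sub>0\<close> and absorbs the terms that lack this ratio into those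
  that have it.\<close>

lemma condition_ge_1: "1 \<le> L * D\<^sup>2 / (\<mu> * \<psi>\<^sup>2)"
proof -
  have "\<mu> * \<psi>\<^sup>2 \<le> L * D\<^sup>2"
    using \<mu>_le_L facial_distance_pos facial_distance_le_diameter \<mu>_pos L_pos
    by (intro mult_mono power_mono) auto
  then show ?thesis
    using \<mu>_pos facial_distance_pos by (simp add: le_divide_eq)
qed

end

context line_search_sweep
begin

text \<open>The scale \<open>s\<^sub>0\<close> balances the error term of \<open>sweep_bound\<close> against strong convexity.\<close>

definition s\<^sub>0 :: real where
  "s\<^sub>0 = \<mu> * \<psi>\<^sup>2 / (4 * real M * L * D\<^sup>2)"

lemma M_pos: "real M > 0"
  using two_vertices by simp

lemma s\<^sub>0_pos: "s\<^sub>0 > 0"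
  using \<mu>_pos L_pos D_pos facial_distance_pos M_pos by (simp add: s\<^sub>0_def)

lemma s\<^sub>0_le: "s\<^sub>0 \<le> 1 / 8"
proof -
  have "8 * (\<mu> * \<psi>\<^sup>2) \<le> (4 * real M) * (L * D\<^sup>2)"
  proof (rule mult_mono)
    show "\<mu> * \<psi>\<^sup>2 \<le> L * D\<^sup>2"
      using condition_ge_1 \<mu>_pos facial_distance_pos by (simp add: le_divide_eq)
  qed (use two_vertices \<mu>_pos in auto)
  moreover have "4 * real M * L * D\<^sup>2 > 0"
    using L_pos D_pos M_pos by simp
  ultimately show ?thesis
    unfolding s\<^sub>0_def by (subst divide_le_eq) (simp add: mult_ac)
qed

lemma f_decrease: "f (x 0) - f (x M) \<ge> 0"
proof -
  have "0 \<le> f (x (j - 1)) - f (x j)" if "j \<in> {1..M}" for j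
    using norm_step_sq_le[OF that] \<mu>_pos zero_le_power2[of "norm (x j - x (j - 1))"]
    by (meson divide_nonneg_nonneg less_imp_le mult_nonneg_nonneg order_trans zero_le_numeral)
  then show ?thesis
    unfolding f_diff_telescope[symmetric] by (intro sum_nonneg)
qed

lemma rescaled_bound:
  assumes "s\<^sub>0 * E \<le> f (x 0) - f (x M) + real M * L / 2 * s\<^sub>0\<^sup>2 * U\<^sup>2"
  shows "E \<le> 4 * real M * (L * D\<^sup>2 / (\<mu> * \<psi>\<^sup>2)) * (f (x 0) - f (x M)) + \<mu> * \<psi>\<^sup>2 / (8 * D\<^sup>2) * U\<^sup>2"
proof -
  have 1: "1 / s\<^sub>0 = 4 * real M * (L * D\<^sup>2 / (\<mu> * \<psi>\<^sup>2))"
    by (simp add: s\<^sub>0_def)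
  have 2: "real M * L / 2 * s\<^sub>0 = \<mu> * \<psi>\<^sup>2 / (8 * D\<^sup>2)"
    using M_pos L_pos by (simp add: s\<^sub>0_def)
  have "E \<le> (f (x 0) - f (x M) + real M * L / 2 * s\<^sub>0\<^sup>2 * U\<^sup>2) / s\<^sub>0"
    using assms s\<^sub>0_pos by (simp add: pos_le_divide_eq mult.commute)
  also have "\<dots> = 1 / s\<^sub>0 * (f (x 0) - f (x M)) + real M * L / 2 * s\<^sub>0 * U\<^sup>2"
    using s\<^sub>0_pos by (simp add: power2_eq_square add_divide_distrib)
  finally show ?thesis by (simp only: 1 2)
qed

lemma sum_tail_le_1:
  assumes "weights m" "j \<in> {1..M}" shows "(\<Sum>i=j..M. m i) \<le> 1"
proof -
  have "(\<Sum>i=j..M. m i) \<le> (\<Sum>i=1..M. m i)"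
    using assms by (intro sum_mono2) (auto simp: weights_def)
  then show ?thesis using assms(1) by (simp add: weights_sum)
qed

text \<open>Moving less than \<open>4 / 5 * \<beta>\<close> keeps the common rescaling factor at
  least 1/5. As \<open>s\<^sub>0\<close> is at most 1/8 and \<open>1 + s\<^sub>0 * T j\<close> at
  least 7/8, feasibility reduces to \<open>1 / 8 \<le> 1 / 5 * (7 / 8)\<close>.\<close>

lemma gap_bound_small_steps:
  assumes m: "weights m" and \<beta>: "\<And>i. i \<in> {1..M} \<Longrightarrow> \<beta> \<le> 1 - w 0 i"
    and small: "5 * (\<Sum>j=1..M. \<eta> j) < 4 * \<beta>"
    and err: "\<psi> * (\<Sum>i=1..M. \<bar>w 0 i - m i\<bar>) \<le> 2 * norm (x 0 - pt m)"
  shows "g 0 \<bullet> (x 0 - pt m) \<le> 4 * real M * (L * D\<^sup>2 / (\<mu> * \<psi>\<^sup>2)) * (f (x 0) - f (x M))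
    + \<mu> / 2 * (norm (x 0 - pt m))\<^sup>2"
proof -
  define \<delta> where "\<delta> i = w 0 i - m i" for i
  define \<rho> where "\<rho> = norm (x 0 - pt m)"
  \<comment> \<open>The l1 error bound times the diameter; with the scale \<open>s\<^sub>0\<close>
    its cost is exactly \<open>\<mu> / 2 * \<rho>\<^sup>2\<close>.\<close>
  define U where "U = 2 * \<rho> / \<psi> * D"
  have \<psi>: "\<psi> > 0" by (rule facial_distance_pos)
  have \<beta>_pos: "\<beta> > 0"
    using small sum_nonneg[of "{1..M}" \<eta>] \<eta>_nonneg by fastforce
  have T: "1 + s\<^sub>0 * (\<Sum>i=j..M. \<delta> i) \<ge> 7 / 8" if j: "j \<in> {1..M}" for j
  proof -
    have "(\<Sum>i=j..M. \<delta> i) \<ge> (\<Sum>i=j..M. - m i)"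
      using j weights_nonneg[OF weights_0] by (intro sum_mono) (auto simp: \<delta>_def)
    then have "(\<Sum>i=j..M. \<delta> i) \<ge> - 1"
      using sum_tail_le_1[OF m j] by (simp add: sum_negf)
    then have "s\<^sub>0 * (\<Sum>i=j..M. \<delta> i) \<ge> s\<^sub>0 * - 1"
      using s\<^sub>0_pos by (intro mult_left_mono) auto
    then show ?thesis using s\<^sub>0_le by simp
  qed
  have feasible: "s\<^sub>0 * \<delta> l \<le> w (j - 1) l * (1 + s\<^sub>0 * (\<Sum>i=j..M. \<delta> i))"
    if j: "j \<in> {1..M}" and "l \<in> {j..M}" for j l
  proof -
    define P where "P = (\<Prod>i=1..j - 1. 1 - a i)"
    have l: "l \<in> {1..M}" "j - 1 < l" using that by auto
    have w0: "w 0 l \<ge> 0" by (rule weights_nonneg[OF weights_0 l(1)])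
    have "\<beta> - (\<Sum>i=1..j - 1. \<eta> i) \<le> \<beta> * P"
      unfolding P_def using small \<beta>_pos by (intro prod_ge \<beta> pred_le[OF j]) auto
    then have "\<beta> * (1 / 5) \<le> \<beta> * P"
      using small \<eta>_sum_mono[OF pred_le[OF j]] by linarith
    then have P: "1 / 5 \<le> P" using \<beta>_pos by simp
    have "s\<^sub>0 * \<delta> l \<le> s\<^sub>0 * w 0 l"
      using s\<^sub>0_pos weights_nonneg[OF m l(1)] by (intro mult_left_mono) (auto simp: \<delta>_def)
    also have "\<dots> \<le> 1 / 8 * w 0 l"
      using s\<^sub>0_le w0 by (intro mult_right_mono) auto
    also have "\<dots> \<le> (1 / 5 * w 0 l) * (7 / 8)"
      using w0 by simp
    also have "\<dots> \<le> (P * w 0 l) * (1 + s\<^sub>0 * (\<Sum>i=j..M. \<delta> i))"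
      using P w0 T[OF j] by (intro mult_mono) auto
    finally show ?thesis
      using w_eq_prod[OF l] by (simp add: P_def)
  qed
  have U: "norm (\<Sum>i=j..M. \<delta> i *\<^sub>R (x (j - 1) - v i)) \<le> U" if j: "j \<in> {1..M}" for j
  proof -
    have "norm (\<Sum>i=j..M. \<delta> i *\<^sub>R (x (j - 1) - v i)) \<le> (\<Sum>i=j..M. \<bar>\<delta> i\<bar> * D)"
      using j norm_vertex_diff_le[OF _ pred_le[OF j]]
      by (intro sum_norm_le) (auto simp: norm_minus_commute intro!: mult_left_mono)
    also have "\<dots> \<le> (\<Sum>i=1..M. \<bar>\<delta> i\<bar> * D)"
      using j D_pos by (intro sum_mono2) auto
    also have "\<dots> = (\<Sum>i=1..M. \<bar>\<delta> i\<bar>) * D"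
      by (simp add: sum_distrib_right)
    also have "\<dots> \<le> U"
      unfolding U_def using err \<psi> D_pos
      by (intro mult_right_mono) (auto simp: \<delta>_def \<rho>_def pos_le_divide_eq mult.commute)
    finally show ?thesis .
  qed
  have bound: "s\<^sub>0 * (\<Sum>i=1..M. \<delta> i * (g 0 \<bullet> (v i - x 0)))
      \<le> f (x 0) - f (x M) + real M * L / 2 * s\<^sub>0\<^sup>2 * U\<^sup>2"
  proof (rule sweep_bound)
    show "0 \<le> 1 + s\<^sub>0 * (\<Sum>i=j..M. \<delta> i)" if "j \<in> {1..M}" for j
      using T[OF that] by simp
  qed (fact feasible U)+
  have gap: "(\<Sum>i=1..M. \<delta> i * (g 0 \<bullet> (v i - x 0))) = g 0 \<bullet> (x 0 - pt m)"
    using gap_decomposition[of 0 m] m by (simp add: \<delta>_def)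
  have U_eq: "\<mu> * \<psi>\<^sup>2 / (8 * D\<^sup>2) * U\<^sup>2 = \<mu> / 2 * \<rho>\<^sup>2"
    using \<psi> D_pos by (simp add: U_def power_mult_distrib power_divide)
  show ?thesis
    using rescaled_bound[OF bound] unfolding gap U_eq \<rho>_def .
qed

text \<open>If the weights move a lot compared with \<open>1 - w 0 k\<close>, then \<open>x 0\<close> is so close to \<open>v k\<close> that one
  can afford to compare with \<open>pt m\<close> through the coefficients \<open>- m i\<close>, that is, without removing
  weight from any vertex, so that every test point is feasible.\<close>

lemma gap_bound_large_steps:
  assumes m: "weights m" and k: "k \<in> {1..M}"
    and large: "4 * (1 - w 0 k) \<le> 5 * (\<Sum>j=1..M. \<eta> j)"
    and err: "\<psi> * (\<Sum>i=1..M. \<bar>w 0 i - m i\<bar>) \<le> 2 * norm (x 0 - pt m)"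
  shows "g 0 \<bullet> (x 0 - pt m) \<le> 4 * real M * (L * D\<^sup>2 / (\<mu> * \<psi>\<^sup>2)) * (f (x 0) - f (x M))
    + 5 * real M * (f (x 0) - f (x M)) + \<mu> / 2 * (norm (x 0 - pt m))\<^sup>2"
proof -
  define \<delta> where "\<delta> i = - m i" for i
  define \<rho> where "\<rho> = norm (x 0 - pt m)"
  define H where "H = (\<Sum>j=1..M. \<eta> j)"
  \<comment> \<open>The mass outside \<open>k\<close> is at most \<open>9 / 4 * H\<close> for
    \<open>w (j - 1)\<close> and at most \<open>5 / 4 * H + \<rho> / \<psi>\<close> for
    \<open>m\<close>; both are charged to the diameter.\<close>
  define U where "U = (\<rho> / \<psi> + 7 / 2 * H) * D"
  have \<psi>: "\<psi> > 0" by (rule facial_distance_pos)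
  have H: "H \<ge> 0" unfolding H_def by (intro sum_nonneg \<eta>_nonneg)
  have T: "1 + s\<^sub>0 * (\<Sum>i=j..M. \<delta> i) \<ge> 0" if j: "j \<in> {1..M}" for j
  proof -
    have "s\<^sub>0 * (\<Sum>i=j..M. m i) \<le> 1 * 1"
      using s\<^sub>0_pos s\<^sub>0_le sum_tail_le_1[OF m j] j weights_nonneg[OF m] by (intro mult_mono sum_nonneg) auto
    then show ?thesis by (simp add: \<delta>_def sum_negf)
  qed
  have feasible: "s\<^sub>0 * \<delta> l \<le> w (j - 1) l * (1 + s\<^sub>0 * (\<Sum>i=j..M. \<delta> i))"
    if j: "j \<in> {1..M}" and "l \<in> {j..M}" for j l
  proof -
    have l: "l \<in> {1..M}" using that by auto
    have "s\<^sub>0 * \<delta> l \<le> 0"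
      using s\<^sub>0_pos weights_nonneg[OF m l] by (simp add: \<delta>_def)
    also have "0 \<le> w (j - 1) l * (1 + s\<^sub>0 * (\<Sum>i=j..M. \<delta> i))"
      using w_pred[OF j l] T[OF j] by simp
    finally show ?thesis .
  qed
  have m_k: "1 - m k \<le> 1 - w 0 k + \<rho> / \<psi>"
  proof -
    \<comment> \<open>Both weight vectors sum to 1, so a surplus at \<open>k\<close> is balanced
      elsewhere and is at most half the l1 distance.\<close>
    have "w 0 k - m k = - (\<Sum>i\<in>{1..M} - {k}. w 0 i - m i)"
      using k by (simp add: sum_diff1 sum_subtractf weights_sum weights_0 m)
    also have "\<dots> \<le> (\<Sum>i\<in>{1..M} - {k}. \<bar>w 0 i - m i\<bar>)"
      unfolding sum_negf[symmetric] by (intro sum_mono) auto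
    finally have "2 * (w 0 k - m k) \<le> (\<Sum>i=1..M. \<bar>w 0 i - m i\<bar>)"
      using k by (subst sum.remove[of _ k]) auto
    then have "\<psi> * (2 * (w 0 k - m k)) \<le> 2 * \<rho>"
      using err \<psi> mult_left_mono[of _ _ \<psi>] unfolding \<rho>_def by (meson less_imp_le order_trans)
    then have "2 * (\<psi> * (w 0 k - m k)) \<le> 2 * \<rho>"
      by (simp only: mult.left_commute)
    then have "\<psi> * (w 0 k - m k) \<le> \<rho>" by simp
    then have "w 0 k - m k \<le> \<rho> / \<psi>"
      using \<psi> by (simp add: pos_le_divide_eq mult.commute)
    then show ?thesis by simp
  qed
  have U: "norm (\<Sum>i=j..M. \<delta> i *\<^sub>R (x (j - 1) - v i)) \<le> U" if j: "j \<in> {1..M}" for j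
  proof -
    have "norm (\<Sum>i=j..M. \<delta> i *\<^sub>R (x (j - 1) - v i)) \<le> (\<Sum>i=j..M. m i * norm (v i - x (j - 1)))"
      using j weights_nonneg[OF m] by (intro sum_norm_le) (auto simp: \<delta>_def norm_minus_commute)
    also have "\<dots> \<le> (\<Sum>i=1..M. m i * norm (v i - x (j - 1)))"
      using j weights_nonneg[OF m] by (intro sum_mono2) auto
    also have "\<dots> = m k * norm (v k - x (j - 1)) + (\<Sum>i\<in>{1..M} - {k}. m i * norm (v i - x (j - 1)))"
      using k by (subst sum.remove[of _ k]) auto
    also have "\<dots> \<le> 1 * norm (v k - x (j - 1)) + (\<Sum>i\<in>{1..M} - {k}. m i * D)"
      using weights_le_1[OF m k] weights_nonneg[OF m] norm_vertex_diff_le[OF _ pred_le[OF j]]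
      by (intro add_mono mult_right_mono sum_mono mult_left_mono) auto
    also have "(\<Sum>i\<in>{1..M} - {k}. m i * D) = (1 - m k) * D"
      using k by (simp add: sum_diff1 weights_sum[OF m] flip: sum_distrib_right)
    also have "1 * norm (v k - x (j - 1)) \<le> (1 - w (j - 1) k) * D"
      using norm_diff_pt_le[OF weights_w[OF pred_le[OF j]] k] x_eq[OF pred_le[OF j]] by simp
    also have "(1 - w (j - 1) k) * D + (1 - m k) * D \<le> U"
    proof -
      define \<omega> where "\<omega> = w (j - 1) k"
      have "1 - \<omega> \<le> 1 - w 0 k + H"
        using w_change_total[OF k pred_le[OF j]] \<eta>_sum_mono[OF pred_le[OF j]] by (simp add: H_def \<omega>_def)
      moreover have "1 - w 0 k \<le> 5 / 4 * H"
        using large by (simp add: H_def)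
      ultimately have "(1 - \<omega>) + (1 - m k) \<le> \<rho> / \<psi> + 7 / 2 * H"
        using m_k by simp
      then have "((1 - \<omega>) + (1 - m k)) * D \<le> U"
        unfolding U_def using D_pos by (intro mult_right_mono) auto
      then show ?thesis by (simp only: distrib_right \<omega>_def)
    qed
    finally show ?thesis by simp
  qed
  have bound: "s\<^sub>0 * (\<Sum>i=1..M. \<delta> i * (g 0 \<bullet> (v i - x 0)))
      \<le> f (x 0) - f (x M) + real M * L / 2 * s\<^sub>0\<^sup>2 * U\<^sup>2"
    by (rule sweep_bound) (fact T feasible U)+
  have gap: "(\<Sum>i=1..M. \<delta> i * (g 0 \<bullet> (v i - x 0))) = g 0 \<bullet> (x 0 - pt m)"
  proof -
    have "(\<Sum>i=1..M. m i *\<^sub>R (v i - x 0)) = pt m - x 0"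
      by (simp add: pt_def scaleR_diff_right sum_subtractf weights_sum[OF m] flip: scaleR_sum_left)
    then have "g 0 \<bullet> (pt m - x 0) = (\<Sum>i=1..M. m i * (g 0 \<bullet> (v i - x 0)))"
      by (metis (no_types, lifting) inner_scaleR_right inner_sum_right sum.cong)
    then show ?thesis by (simp add: \<delta>_def sum_negf inner_diff_right)
  qed
  have "g 0 \<bullet> (x 0 - pt m) \<le> 4 * real M * (L * D\<^sup>2 / (\<mu> * \<psi>\<^sup>2)) * (f (x 0) - f (x M))
      + \<mu> * \<psi>\<^sup>2 / (8 * D\<^sup>2) * U\<^sup>2"
    using rescaled_bound[OF bound] unfolding gap .
  also have "\<mu> * \<psi>\<^sup>2 / (8 * D\<^sup>2) * U\<^sup>2 = \<mu> / 8 * (\<rho> + 7 / 2 * (\<psi> * H))\<^sup>2"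
    using \<psi> D_pos by (simp add: U_def power_mult_distrib[symmetric]) (simp add: power2_eq_square field_simps)
  also have "\<dots> \<le> \<mu> / 8 * (4 * \<rho>\<^sup>2 + 20 * (\<psi> * H)\<^sup>2)"
  proof -
    \<comment> \<open>This weighting gives \<open>\<rho>\<^sup>2\<close> the coefficient 4, which
      becomes \<open>\<mu> / 2\<close>; the bound \<open>49 / 3 \<le> 20\<close> then yields
      \<open>5 * real M\<close> below.\<close>
    have "0 \<le> (3 * \<rho> - 7 / 2 * (\<psi> * H))\<^sup>2" by simp
    then have "3 * (\<rho> + 7 / 2 * (\<psi> * H))\<^sup>2 \<le> 12 * \<rho>\<^sup>2 + 49 * (\<psi> * H)\<^sup>2"
      by (simp add: power2_eq_square algebra_simps)
    then have "(\<rho> + 7 / 2 * (\<psi> * H))\<^sup>2 \<le> 4 * \<rho>\<^sup>2 + 20 * (\<psi> * H)\<^sup>2"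
      using zero_le_power2[of "\<psi> * H"] by linarith
    then show ?thesis using \<mu>_pos by (intro mult_left_mono) auto
  qed
  also have "\<dots> = \<mu> / 2 * \<rho>\<^sup>2 + 5 / 2 * \<mu> * (\<psi> * H)\<^sup>2"
    by (simp add: algebra_simps)
  also have "5 / 2 * \<mu> * (\<psi> * H)\<^sup>2 \<le> 5 * real M * (f (x 0) - f (x M))"
  proof -
    have "\<psi> * H \<le> (\<Sum>j=1..M. norm (x j - x (j - 1)))"
      unfolding H_def sum_distrib_left by (intro sum_mono \<eta>_le_norm_step)
    then have "(\<psi> * H)\<^sup>2 \<le> (\<Sum>j=1..M. norm (x j - x (j - 1)))\<^sup>2"
      using \<psi> H by (intro power_mono) auto
    also have "\<dots> \<le> 2 * real M * (f (x 0) - f (x M)) / \<mu>"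
      by (rule sum_norm_step_sq[OF \<mu>_pos norm_step_sq_le])
    finally have "5 / 2 * \<mu> * (\<psi> * H)\<^sup>2 \<le> 5 / 2 * \<mu> * (2 * real M * (f (x 0) - f (x M)) / \<mu>)"
      using \<mu>_pos by (intro mult_left_mono) auto
    then show ?thesis using \<mu>_pos by simp
  qed
  finally show ?thesis by (simp add: \<rho>_def)
qed

text \<open>The cases are split at the heaviest vertex \<open>k\<close>, for which
  \<open>1 - w 0 k\<close> is the least mass outside any vertex. The constant 9 is 4 from
  \<open>s\<^sub>0\<close> plus 5 from the large-step case.\<close>

lemma line_search_sweep_progress:
  assumes y: "y \<in> S"
  shows "f (x 0) - f y \<le> 9 * real M * L * D\<^sup>2 / (\<mu> * \<psi>\<^sup>2) * (f (x 0) - f (x M))"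
proof -
  define K where "K = L * D\<^sup>2 / (\<mu> * \<psi>\<^sup>2)"
  define \<Delta> where "\<Delta> = f (x 0) - f (x M)"
  have \<Delta>: "0 \<le> real M * \<Delta>" and K\<Delta>: "real M * \<Delta> \<le> K * (real M * \<Delta>)"
    using f_decrease condition_ge_1 mult_right_mono[of 1 K "real M * \<Delta>"] by (auto simp: \<Delta>_def K_def)
  obtain m where m: "weights m" "pt m = y"
    and err: "\<psi> * (\<Sum>i=1..M. \<bar>w 0 i - m i\<bar>) \<le> 2 * norm (x 0 - pt m)"
    using weights_error_bound[OF weights_0 y] x_0 by metis
  have "1 \<in> {1..M}" using two_vertices by auto
  then obtain k where k: "k \<in> {1..M}" "\<And>i. i \<in> {1..M} \<Longrightarrow> w 0 i \<le> w 0 k"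
    using Max_in[of "w 0 ` {1..M}"] Max_ge[of "w 0 ` {1..M}"] by fastforce
  have "g 0 \<bullet> (x 0 - pt m) \<le> 9 * K * (real M * \<Delta>) + \<mu> / 2 * (norm (x 0 - pt m))\<^sup>2"
  proof (cases "5 * (\<Sum>j=1..M. \<eta> j) < 4 * (1 - w 0 k)")
    case True
    from gap_bound_small_steps[OF m(1) _ this err]
    have "g 0 \<bullet> (x 0 - pt m) \<le> 4 * (K * (real M * \<Delta>)) + \<mu> / 2 * (norm (x 0 - pt m))\<^sup>2"
      using k(2) by (simp add: K_def \<Delta>_def mult_ac)
    then show ?thesis using \<Delta> K\<Delta> by simp
  next
    case False
    then have "4 * (1 - w 0 k) \<le> 5 * (\<Sum>j=1..M. \<eta> j)" by simp
    from gap_bound_large_steps[OF m(1) k(1) this err]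
    have "g 0 \<bullet> (x 0 - pt m) \<le> 4 * (K * (real M * \<Delta>)) + 5 * (real M * \<Delta>) + \<mu> / 2 * (norm (x 0 - pt m))\<^sup>2"
      by (simp add: K_def \<Delta>_def mult_ac)
    then show ?thesis using K\<Delta> by simp
  qed
  moreover have "f (x 0) - f y \<le> g 0 \<bullet> (x 0 - pt m) - \<mu> / 2 * (norm (x 0 - pt m))\<^sup>2"
    using strong_lower_bound[OF y, of 0] by (simp add: m norm_minus_commute inner_diff_right)
  ultimately have "f (x 0) - f y \<le> 9 * K * (real M * \<Delta>)" by linarith
  then show ?thesis by (simp add: K_def \<Delta>_def mult_ac)
qed

end

section \<open>Linear convergence\<close>

lemma geometric_decrease:
  fixes h :: "nat \<Rightarrow> real"
  assumes "c > 0" and "\<And>t. h (Suc t) \<le> c * (h t - h (Suc t))"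
  shows "h t \<le> (c / (1 + c)) ^ t * h 0"
proof (induction t)
  case (Suc t)
  have "h (Suc t) * (1 + c) \<le> c * h t"
    using assms(2)[of t] by (simp add: algebra_simps)
  then have "h (Suc t) \<le> c / (1 + c) * h t"
    using assms(1) by (simp add: pos_le_divide_eq)
  also have "\<dots> \<le> c / (1 + c) * ((c / (1 + c)) ^ t * h 0)"
    using Suc assms(1) by (intro mult_left_mono) auto
  finally show ?case by simp
qed simp

text \<open>Induction is needed because the locale presupposes valid starting weights, which the end
  of the previous sweep supplies.\<close>

lemma PolyCDwA_sweep:
  assumes "vertex_polytope S M v" "L > 0" "\<mu> > 0" "smooth_on_set L S f" "strongly_convex_on_set \<mu> S f"
    and alg: "PolyCDwA S M v X lam alpha"
  shows "sweep S M v f L \<mu> (X t) (lam t) (alpha t)"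
proof (induction t)
  interpret vertex_polytope S M v by (fact assms(1))
  have step: "sweep S M v f L \<mu> (X t) (lam t) (alpha t)"
    if "weights (lam t 0)" "X t 0 = pt (lam t 0)" for t
    using that assms unfolding PolyCDwA_def
    by unfold_locales auto
  case 0
  show ?case
    using alg by (intro step) (auto simp: PolyCDwA_def weights_def pt_def)
  case (Suc t)
  interpret sweep S M v f L \<mu> "X t" "lam t" "alpha t" by (fact Suc)
  have next_lam: "lam (Suc t) 0 j = lam t M j" if "j \<in> {1..M}" for j
    using alg that by (simp add: PolyCDwA_def)
  have "weights (lam (Suc t) 0)"
    using weights_w[OF order_refl] next_lam by (simp add: weights_def)
  moreover have "X (Suc t) 0 = X t M"
    using alg by (simp add: PolyCDwA_def)
  then have "X (Suc t) 0 = pt (lam (Suc t) 0)"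
    using x_eq[OF order_refl] next_lam by (simp add: pt_def)
  ultimately show ?case by (rule step)
qed

theorem theorem3p2:
  fixes S :: "'a::euclidean_space set"
    and f :: "'a \<Rightarrow> real"
    and v :: "nat \<Rightarrow> 'a"
    and M :: nat
    and L \<mu> D \<psi> fstar :: real
    and X :: "nat \<Rightarrow> nat \<Rightarrow> 'a"
    and lam :: "nat \<Rightarrow> nat \<Rightarrow> nat \<Rightarrow> real"
    and alpha :: "nat \<Rightarrow> nat \<Rightarrow> real"
  assumes "polytope S"
    and "M \<ge> 2"
    and "bij_betw v {1..M} (vertices S)"
    and "D = diameter S"
    and "\<psi> = facial_distance S"
    and "L > 0" and "\<mu> > 0"
    and "convex_on UNIV f"
    and "smooth_on_set L S f"
    and "strongly_convex_on_set \<mu> S f"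
    and "fstar = (INF x\<in>S. f x)"
    and "PolyCDwA S M v X lam alpha"
  shows "(line_search_steps f M v X lam alpha \<longrightarrow>
           (let G = 1 + 9 * real M * L * D\<^sup>2 / (\<mu> * \<psi>\<^sup>2) in
            \<forall>t. f (X t 0) - fstar \<le> (G / (1 + G)) ^ t * (f (X 0 0) - fstar)))
       \<and> (gradient_steps L f M v X lam alpha \<longrightarrow>
           (let G' = 2 + 16 * real M * L * D\<^sup>2 / (\<mu> * \<psi>\<^sup>2) in
            \<forall>t. f (X t 0) - fstar \<le> (G' / (1 + G')) ^ t * (f (X 0 0) - fstar)))"
proof -
  interpret vertex_polytope S M v
    by (rule vertex_polytope.intro) fact+
  have sweep: "sweep S M v f L \<mu> (X t) (lam t) (alpha t)" for t
    by (rule PolyCDwA_sweep[OF vertex_polytope_axioms]) fact+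
  have next_X: "X (Suc t) 0 = X t M" for t
    using assms(12) by (simp add: PolyCDwA_def)
  \<comment> \<open>By compactness the infimum \<open>fstar\<close> is attained at some
    \<open>y\<close>, the comparison point for every sweep.\<close>
  have "continuous_on S f"
    using assms(9) by (auto simp: smooth_on_set_def intro!: differentiable_imp_continuous_on
        differentiable_at_imp_differentiable_on)
  moreover have "S \<noteq> {}"
    using assms(12) by (auto simp: PolyCDwA_def)
  ultimately obtain y where y: "y \<in> S" "\<And>z. z \<in> S \<Longrightarrow> f y \<le> f z"
    using continuous_attains_inf[OF compact_S] by metis
  have "fstar = f y"
    unfolding assms(11) using y by (intro cInf_eq_minimum) auto
  have nonneg: "0 \<le> real M * L * D\<^sup>2 / (\<mu> * \<psi>\<^sup>2)"
    using assms(6,7) by simp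
  show ?thesis
    unfolding Let_def
  proof (intro conjI impI)
    let ?G = "1 + 9 * real M * L * D\<^sup>2 / (\<mu> * \<psi>\<^sup>2)"
    assume ls: "line_search_steps f M v X lam alpha"
    show "\<forall>t. f (X t 0) - fstar \<le> (?G / (1 + ?G)) ^ t * (f (X 0 0) - fstar)"
    proof (intro allI geometric_decrease)
      show "?G > 0" using nonneg by (simp add: add_pos_nonneg)
      fix t
      interpret sweep S M v f L \<mu> "X t" "lam t" "alpha t" by (fact sweep)
      interpret line_search_sweep S M v f L \<mu> "X t" "lam t" "alpha t"
        using ls by unfold_locales (auto simp: line_search_steps_def)
      define c where "c = 9 * real M * L * D\<^sup>2 / (\<mu> * \<psi>\<^sup>2)"
      have "f (X t 0) - f y \<le> c * (f (X t 0) - f (X t M))"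
        using line_search_sweep_progress[OF y(1)] by (simp only: assms(4,5) c_def)
      \<comment> \<open>The sweep estimate bounds the gap at the first point, while
        \<open>geometric_decrease\<close> needs it at the last one.\<close>
      then have "f (X t M) - f y \<le> (1 + c) * (f (X t 0) - f (X t M))"
        using f_decrease by (simp add: distrib_right)
      then show "f (X (Suc t) 0) - fstar \<le> ?G * (f (X t 0) - fstar - (f (X (Suc t) 0) - fstar))"
        by (simp add: next_X \<open>fstar = f y\<close> c_def)
    qed
  next
    let ?G' = "2 + 16 * real M * L * D\<^sup>2 / (\<mu> * \<psi>\<^sup>2)"
    assume gs: "gradient_steps L f M v X lam alpha"
    show "\<forall>t. f (X t 0) - fstar \<le> (?G' / (1 + ?G')) ^ t * (f (X 0 0) - fstar)"
    proof (intro allI geometric_decrease)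
      show "?G' > 0" using nonneg by (simp add: add_pos_nonneg)
      fix t
      interpret sweep S M v f L \<mu> "X t" "lam t" "alpha t" by (fact sweep)
      interpret gradient_sweep S M v f L \<mu> "X t" "lam t" "alpha t"
        using gs by unfold_locales (auto simp: gradient_steps_def)
      have "f (X t M) - f y \<le> (1 + 16 * real M * L * D\<^sup>2 / (\<mu> * \<psi>\<^sup>2)) * (f (X t 0) - f (X t M))"
        using gradient_sweep_progress[OF y(1)] by (simp only: assms(4,5))
      also have "\<dots> \<le> ?G' * (f (X t 0) - f (X t M))"
        by (intro mult_right_mono f_decrease) auto
      finally show "f (X (Suc t) 0) - fstar \<le> ?G' * (f (X t 0) - fstar - (f (X (Suc t) 0) - fstar))"
        by (simp add: next_X \<open>fstar = f y\<close>)
    qed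
  qed
qed

end
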